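(* Assume: (i) $\Theta\subset\mathbb{R}^l$ is compact; (ii) for every $n$, $\mathbb{P}^n_\theta$ has a density $p^n_\theta(\cdot)$ (with respect to a $\sigma$-finite measure on $\Xi^n$ not depending on $\theta$) that is jointly measurable in $\theta\in\Theta$ and its argument in $\Xi^n$ (write $p_\theta=p^1_\theta$); (iii) for any neighborhood $V\in\mathcal{B}_\Theta$ of $\theta^c$ there exists a sequence of uniformly consistent tests of the hypothesis $\tilde\theta=\theta^c$ against the alternative $\tilde\theta\in\Theta\setminus V$; (iv) for any $\epsilon>0$ and any neighborhood $V\in\mathcal{B}_\Theta$ of $\theta^c$, $V$ contains a subset $W$ such that $\pi(W)>0$ and $D_{KL}(p_{\theta^c}\,\|\,p_\theta)<\epsilon$ for all $\theta\in W$. Suppose also that $H(x,\cdot)$ is continuous on $\Theta$ for every $x\in\mathcal{X}$. Then for every fixed $x\in\mathcal{X}$, $$\rho_{\mathbb{P}_n}[H(x,\theta)]\to H(x,\theta^c)\quad\text{as } n\to\infty,\qquad \mathbb{P}^{\mathbb{N}}_{\theta^c}\text{-almost surely},$$ for each of the following four choices of $\rho$: the mean $\mathbb{E}_{\mathbb{P}_n}[\cdot]$; the mean-variance $\mathbb{E}_{\mathbb{P}_n}[\cdot]+w\,\mathrm{Var}_{\mathbb{P}_n}[\cdot]$ with $w\ge 0$; $\mathrm{VaR}^\alpha_{\mathbb{P}_n}$ with $\alpha\in(0,1)$; and $\mathrm{CVaR}^\alpha_{\mathbb{P}_n}$ with $\alpha\in(0,1)$.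
   Context: Setting. $\Theta\subset\mathbb{R}^l$ carries its Borel $\sigma$-algebra $\mathcal{B}_\Theta$ and a prior probability measure $\pi$; $\Xi\subset\mathbb{R}^m$ carries its Borel $\sigma$-algebra $\mathcal{B}_\Xi$ and a family of probability measures $\{\mathbb{P}_\theta\}_{\theta\in\Theta}$. $\mathbb{P}^n_\theta$ and $\mathbb{P}^{\mathbb{N}}_\theta$ are the $n$-fold and countably infinite product measures on $\Xi^n$ and $\Xi^{\mathbb{N}}$; it is assumed that $\theta\mapsto\mathbb{P}^{\mathbb{N}}_\theta(B)$ is measurable for every measurable $B\subset\Xi^{\mathbb{N}}$. $\theta^c\in\Theta$ is the fixed true parameter. The data $\xi_1,\xi_2,\dots$ are the coordinates on $\Xi^{\mathbb{N}}$ (i.i.d. with law $\mathbb{P}_{\theta^c}$ under $\mathbb{P}^{\mathbb{N}}_{\theta^c}$). $\tilde\theta$ denotes the Bayesian parameter with prior $\pi$, and $\mathbb{P}_n$ is its posterior distribution given $\xi_1,\dots,\xi_n$, i.e. $\mathbb{P}_n(A)=\int_A p^n_\theta(\xi_1,\dots,\xi_n)\,\pi(d\theta)\big/\int_\Theta p^n_\theta(\xi_1,\dots,\xi_n)\,\pi(d\theta)$ for $A\in\mathcal{B}_\Theta$. $\mathcal{X}\subset\mathbb{R}^d$ is closed, $h:\mathbb{R}^d\times\mathbb{R}^m\to\mathbb{R}$, and $H(x,\theta):=\mathbb{E}_{\mathbb{P}_\theta}[h(x,\xi)]$ is assumed finite for all $(x,\theta)\in\mathcal{X}\times\Theta$.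 A sequence of uniformly consistent tests of $\tilde\theta=\theta^c$ against $\tilde\theta\in\Theta\setminus V$ is a sequence of measurable $\varphi_n:\Xi^n\to[0,1]$ with $\mathbb{E}_{\mathbb{P}^n_{\theta^c}}[\varphi_n]\to0$ and $\sup_{\theta\in\Theta\setminus V}\mathbb{E}_{\mathbb{P}^n_\theta}[1-\varphi_n]\to0$. $D_{KL}$ is the Kullback–Leibler divergence. $\rho_{\mathbb{P}_n}[H(x,\theta)]$ means the functional $\rho$ applied to the random variable $H(x,\theta)$ with $\theta\sim\mathbb{P}_n$. For a random variable $X$: $\mathrm{VaR}^\alpha(X):=\inf\{t:\mathbb{P}(X\le t)\ge\alpha\}$ and $\mathrm{CVaR}^\alpha(X):=\frac{1}{1-\alpha}\int_\alpha^1\mathrm{VaR}^r(X)\,dr$. *)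

theory Defs
  imports "HOL-Probability.Probability"
begin

abbreviation borel_on :: "'a::topological_space set \<Rightarrow> 'a measure" where
  "borel_on S \<equiv> restrict_space borel S"

abbreviation prod_n :: "nat \<Rightarrow> 'a measure \<Rightarrow> (nat \<Rightarrow> 'a) measure" where
  "prod_n n M \<equiv> PiM {..<n} (\<lambda>_. M)"

abbreviation prod_inf :: "'a measure \<Rightarrow> (nat \<Rightarrow> 'a) measure" where
  "prod_inf M \<equiv> PiM UNIV (\<lambda>_. M)"

definition nbhd_in :: "'a::topological_space set \<Rightarrow> 'a \<Rightarrow> 'a set \<Rightarrow> bool" where
  "nbhd_in S a V \<longleftrightarrow> V \<subseteq> S \<and> (\<exists>U. openin (top_of_set S) U \<and> a \<in> U \<and> U \<subseteq> V)"

text \<open>The supremum is taken in \<^typ>\<open>ennreal\<close>, where it is \<open>0\<close> over the empty set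
  (the case \<open>V = \<Theta>\<close>).\<close>

definition uniformly_consistent_tests ::
  "'a set \<Rightarrow> 'b::topological_space set \<Rightarrow> ('a \<Rightarrow> 'b measure) \<Rightarrow> 'a \<Rightarrow> 'a set
    \<Rightarrow> (nat \<Rightarrow> (nat \<Rightarrow> 'b) \<Rightarrow> real) \<Rightarrow> bool" where
  "uniformly_consistent_tests \<Theta> \<Xi> P \<theta>c V \<phi> \<longleftrightarrow>
     (\<forall>n. \<phi> n \<in> borel_measurable (prod_n n (borel_on \<Xi>)) \<and>
          (\<forall>\<xi>\<in>space (prod_n n (borel_on \<Xi>)). 0 \<le> \<phi> n \<xi> \<and> \<phi> n \<xi> \<le> 1)) \<and>
     (\<lambda>n. \<integral>\<xi>. \<phi> n \<xi> \<partial>prod_n n (P \<theta>c)) \<longlonglongrightarrow> 0 \<and>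
     (\<lambda>n. SUP \<theta>\<in>\<Theta> - V. ennreal (\<integral>\<xi>. 1 - \<phi> n \<xi> \<partial>prod_n n (P \<theta>))) \<longlonglongrightarrow> 0"

text \<open>Divergence of the density \<open>p\<close> from the density \<open>q\<close> with respect to \<open>M\<close>, in natural
  logarithm. The library's \<^const>\<open>KL_divergence\<close> has its reference measure first, and as a
  Bochner integral it is \<open>0\<close> when the divergence is infinite; the negative part of the
  log-density ratio is always integrable, so for absolutely continuous measures
  non-integrability means that the divergence is \<open>\<infinity>\<close>.\<close>

definition D_KL :: "'a measure \<Rightarrow> ('a \<Rightarrow> real) \<Rightarrow> ('a \<Rightarrow> real) \<Rightarrow> ereal" where
  "D_KL M p q =
     (let P = density M (\<lambda>x. ennreal (p x)); Q = density M (\<lambda>x. ennreal (q x)) in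
      if absolutely_continuous Q P \<and> integrable P (entropy_density (exp 1) Q P)
      then ereal (KL_divergence (exp 1) Q P) else \<infinity>)"

text \<open>The data \<open>\<xi>\<^sub>1, \<dots>, \<xi>\<^sub>n\<close> are the coordinates \<open>\<omega> 0, \<dots>, \<omega> (n - 1)\<close> of \<open>\<omega>\<close>. By the lemma
  below, this density gives the posterior as the quotient of the two integrals.\<close>

definition posterior ::
  "'a measure \<Rightarrow> (nat \<Rightarrow> 'a \<Rightarrow> (nat \<Rightarrow> 'b) \<Rightarrow> real) \<Rightarrow> nat \<Rightarrow> (nat \<Rightarrow> 'b) \<Rightarrow> 'a measure" where
  "posterior \<pi> p n \<omega> =
     density \<pi> (\<lambda>\<theta>. ennreal (p n \<theta> (restrict \<omega> {..<n})) /
                    (\<integral>\<^sup>+\<theta>'. ennreal (p n \<theta>' (restrict \<omega> {..<n})) \<partial>\<pi>))"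

lemma emeasure_posterior:
  assumes "(\<lambda>\<theta>. p n \<theta> (restrict \<omega> {..<n})) \<in> borel_measurable \<pi>" "A \<in> sets \<pi>"
  shows "emeasure (posterior \<pi> p n \<omega>) A =
    (\<integral>\<^sup>+\<theta>\<in>A. ennreal (p n \<theta> (restrict \<omega> {..<n})) \<partial>\<pi>) /
    (\<integral>\<^sup>+\<theta>. ennreal (p n \<theta> (restrict \<omega> {..<n})) \<partial>\<pi>)"
proof -
  let ?c = "\<integral>\<^sup>+\<theta>. ennreal (p n \<theta> (restrict \<omega> {..<n})) \<partial>\<pi>"
  have "emeasure (posterior \<pi> p n \<omega>) A =
      (\<integral>\<^sup>+\<theta>. (ennreal (p n \<theta> (restrict \<omega> {..<n})) / ?c) * indicator A \<theta> \<partial>\<pi>)"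
    unfolding posterior_def using assms by (subst emeasure_density) auto
  also have "\<dots> = (\<integral>\<^sup>+\<theta>. (ennreal (p n \<theta> (restrict \<omega> {..<n})) * indicator A \<theta>) / ?c \<partial>\<pi>)"
    by (simp add: divide_ennreal_def mult_ac)
  also have "\<dots> = (\<integral>\<^sup>+\<theta>\<in>A. ennreal (p n \<theta> (restrict \<omega> {..<n})) \<partial>\<pi>) / ?c"
    using assms by (intro nn_integral_divide) auto
  finally show ?thesis .
qed

text \<open>\<open>H(x, \<theta>)\<close>, meaningful where \<open>h x\<close> is integrable.\<close>

definition mean_cost :: "('a \<Rightarrow> 'b measure) \<Rightarrow> ('c \<Rightarrow> 'b \<Rightarrow> real) \<Rightarrow> 'c \<Rightarrow> 'a \<Rightarrow> real" where
  "mean_cost P h x \<theta> = (\<integral>\<xi>. h x \<xi> \<partial>P \<theta>)"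

definition mean_risk :: "'a measure \<Rightarrow> ('a \<Rightarrow> real) \<Rightarrow> real" where
  "mean_risk M X = prob_space.expectation M X"

definition mean_variance_risk :: "real \<Rightarrow> 'a measure \<Rightarrow> ('a \<Rightarrow> real) \<Rightarrow> real" where
  "mean_variance_risk w M X = prob_space.expectation M X + w * prob_space.variance M X"

text \<open>For general \<open>X\<close> the set is nonempty and bounded below only if \<open>0 < \<alpha> < 1\<close>; hence the open
  interval in the integral below, whose endpoints are negligible.\<close>

definition VaR :: "real \<Rightarrow> 'a measure \<Rightarrow> ('a \<Rightarrow> real) \<Rightarrow> real" where
  "VaR \<alpha> M X = Inf {t. measure M {\<theta>\<in>space M. X \<theta> \<le> t} \<ge> \<alpha>}"

definition CVaR :: "real \<Rightarrow> 'a measure \<Rightarrow> ('a \<Rightarrow> real) \<Rightarrow> real" where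
  "CVaR \<alpha> M X = 1 / (1 - \<alpha>) * (LINT r:{\<alpha><..<1}|lborel. VaR r M X)"

end

theory Submission
  imports Defs
begin

text \<open>By Schwartz's theorem the posterior concentrates, almost surely, on every neighbourhood \<open>V\<close> of
  \<open>\<theta>c\<close>; as \<open>H x\<close> is bounded and continuous, all four risk functionals then converge to
  \<open>H x \<theta>c\<close>. Write the posterior mass of the complement of \<open>V\<close> as a quotient of two integrals of the
  likelihood ratio against \<open>\<theta>c\<close>. A consistent test applied to consecutive blocks of observations makes
  the numerator exponentially small. For the denominator, the log-likelihood ratio of each \<open>\<theta>\<close> with
  divergence below \<open>c\<close> is eventually above \<open>- c n\<close>; a maximal ergodic inequality
  gives this one-sided strong law from integrability alone. By Fubini's theorem and Fatou's lemma
  \<open>exp (c n)\<close> times the denominator tends to infinity for every \<open>c > 0\<close>.\<close>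

text \<open>The tests come without a rate, and the measures \<open>\<nu> n\<close> for different n
  are unrelated, so neither an exponential bound nor a product formula for \<open>p n\<close> is
  given. The first gap is closed by fixing one sample size k at which both error probabilities are
  at most 1/10. The numerator then decays at a rate set by k alone; as the divergence hypothesis
  holds for every bound, c is chosen afterwards, small enough that \<open>exp (c n)\<close> does not
  outgrow this rate. The second gap is closed by the density of \<open>P \<theta>c\<close> with
  respect to \<open>P \<theta>\<close>, which finite divergence provides and whose products give the
  likelihood ratios. Finite divergence yields a first moment of the log-ratio and no second one,
  hence the maximal inequality. The exceptional null set of each strong law depends on
  \<open>\<theta>\<close>, hence Fubini's theorem. Densities are described for n at least 1 only, so
  indices run over \<open>Suc n\<close>; and the posterior is known to have mass one only from some
  n on that depends on the data, so the risk functionals are first treated for probability measures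
  and then along a tail of the sequence.\<close>

section \<open>Risk functionals under concentration\<close>

lemma (in prob_space) bound_nonneg:
  fixes X :: "'a \<Rightarrow> real"
  assumes "\<And>x. x \<in> space M \<Longrightarrow> \<bar>X x\<bar> \<le> B"
  shows "0 \<le> B"
proof -
  obtain x where "x \<in> space M" using not_empty by blast
  from assms[OF this] show ?thesis by linarith
qed

text \<open>The measure changes with n, so dominated convergence does not apply directly. Instead
  \<open>Y n\<close> is bounded by \<open>e\<close> plus \<open>K\<close> times the indicator of the
  event that it reaches \<open>e\<close>.\<close>

lemma expectation_tendsto_0:
  fixes Q :: "nat \<Rightarrow> 'a measure" and Y :: "nat \<Rightarrow> 'a \<Rightarrow> real"
  assumes Q: "\<And>n. prob_space (Q n)"
    and Y[measurable]: "\<And>n. Y n \<in> borel_measurable (Q n)"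
    and bound: "\<And>n x. x \<in> space (Q n) \<Longrightarrow> 0 \<le> Y n x \<and> Y n x \<le> K"
    and conv: "\<And>e. 0 < e \<Longrightarrow> (\<lambda>n. measure (Q n) {x\<in>space (Q n). e \<le> Y n x}) \<longlonglongrightarrow> 0"
  shows "(\<lambda>n. \<integral>x. Y n x \<partial>Q n) \<longlonglongrightarrow> 0"
proof (rule LIMSEQ_I)
  fix r :: real assume r: "0 < r"
  have K: "0 \<le> K"
    by (rule prob_space.bound_nonneg[OF Q, of 0 "Y 0"]) (use bound[of _ 0] in simp)
  define e where "e = r / 2"
  have e: "0 < e" using r by (simp add: e_def)
  have le: "(\<integral>x. Y n x \<partial>Q n) \<le> e + K * measure (Q n) {x\<in>space (Q n). e \<le> Y n x}" for n
  proof -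
    interpret prob_space "Q n" by (rule Q)
    have "(\<integral>x. Y n x \<partial>Q n) \<le> (\<integral>x. e + K * indicator {x\<in>space (Q n). e \<le> Y n x} x \<partial>Q n)"
    proof (rule integral_mono)
      show "integrable (Q n) (Y n)"
        by (rule integrable_const_bound[of _ K]) (use bound in auto)
      show "integrable (Q n) (\<lambda>x. e + K * indicator {x\<in>space (Q n). e \<le> Y n x} x)"
        by (intro Bochner_Integration.integrable_add integrable_mult_right integrable_real_indicator)
           (auto simp: emeasure_eq_measure)
      show "Y n x \<le> e + K * indicator {x\<in>space (Q n). e \<le> Y n x} x" if "x \<in> space (Q n)" for x
        using bound[OF that] that e by (auto simp: indicator_def)
    qed
    also have "\<dots> = e + K * measure (Q n) {x\<in>space (Q n). e \<le> Y n x}"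
      by (subst Bochner_Integration.integral_add)
         (auto simp: emeasure_eq_measure prob_space integrable_real_indicator)
    finally show ?thesis .
  qed
  have "(\<lambda>n. K * measure (Q n) {x\<in>space (Q n). e \<le> Y n x}) \<longlonglongrightarrow> 0"
    using tendsto_mult_right_zero[OF conv[OF e]] .
  from LIMSEQ_D[OF this e] obtain N where
    "\<And>n. n \<ge> N \<Longrightarrow> \<bar>K * measure (Q n) {x\<in>space (Q n). e \<le> Y n x}\<bar> < e" by auto
  moreover have "0 \<le> (\<integral>x. Y n x \<partial>Q n)" for n
    by (rule integral_nonneg_AE) (use bound in auto)
  ultimately have "norm ((\<integral>x. Y n x \<partial>Q n) - 0) < r" if "n \<ge> N" for n
    using le[of n] that unfolding e_def by fastforce
  then show "\<exists>N. \<forall>n\<ge>N. norm ((\<integral>x. Y n x \<partial>Q n) - 0) < r" by blast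
qed

text \<open>The deviation bound acts twice: mass below \<open>1 - r\<close> outside leaves at least
  \<open>r\<close> at or below \<open>c + e\<close>, and mass below \<open>r\<close> outside keeps
  every \<open>t\<close> below \<open>c - e\<close> from collecting \<open>r\<close>. Together they
  give the nonemptiness and the lower bound that \<open>Inf\<close> on the reals requires.\<close>

lemma VaR_set_bounds:
  fixes X :: "'a \<Rightarrow> real"
  assumes "prob_space M" and X[measurable]: "X \<in> borel_measurable M"
    and r: "0 < r" "r < 1"
    and dev: "measure M {x\<in>space M. e \<le> \<bar>X x - c\<bar>} < min r (1 - r)" and e: "0 \<le> e"
  shows "measure M {x\<in>space M. X x \<le> c + e} \<ge> r"
    and "\<And>t. measure M {x\<in>space M. X x \<le> t} \<ge> r \<Longrightarrow> c - e \<le> t"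
proof -
  interpret prob_space M by fact
  have "1 - measure M {x\<in>space M. e \<le> \<bar>X x - c\<bar>} = measure M {x\<in>space M. \<not> e \<le> \<bar>X x - c\<bar>}"
    by (rule prob_neg[symmetric]) measurable
  also have "\<dots> \<le> measure M {x\<in>space M. X x \<le> c + e}"
    by (rule finite_measure_mono) auto
  finally show "measure M {x\<in>space M. X x \<le> c + e} \<ge> r"
    using dev by linarith
  show "c - e \<le> t" if t: "measure M {x\<in>space M. X x \<le> t} \<ge> r" for t
  proof (rule ccontr)
    assume "\<not> c - e \<le> t"
    then have "measure M {x\<in>space M. X x \<le> t} \<le> measure M {x\<in>space M. e \<le> \<bar>X x - c\<bar>}"
      by (intro finite_measure_mono) auto
    with t dev show False by linarith
  qed
qed

lemma VaR_near:
  assumes "prob_space M" "X \<in> borel_measurable M" "0 < r" "r < 1"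
    and "measure M {x\<in>space M. e \<le> \<bar>X x - c\<bar>} < min r (1 - r)" "0 \<le> e"
  shows "\<bar>VaR r M X - c\<bar> \<le> e"
proof -
  note b = VaR_set_bounds[OF assms]
  have "VaR r M X \<le> c + e"
    unfolding VaR_def
    by (rule cInf_lower) (use b(1) in simp, rule bdd_belowI[of _ "c - e"], use b(2) in simp)
  moreover have "c - e \<le> VaR r M X"
    unfolding VaR_def by (rule cInf_greatest) (use b(1) in blast, use b(2) in simp)
  ultimately show ?thesis by linarith
qed

text \<open>The \<open>- 0\<close> makes the set an instance of the deviation event of
  \<open>VaR_set_bounds\<close> with centre 0, which is how plain boundedness of \<open>X\<close>
  enters there.\<close>

lemma measure_deviation_eq_0:
  fixes X :: "'a \<Rightarrow> real"
  assumes "\<And>x. x \<in> space M \<Longrightarrow> \<bar>X x\<bar> \<le> B" "B < e"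
  shows "measure M {x\<in>space M. e \<le> \<bar>X x - 0\<bar>} = 0"
proof -
  have "\<not> e \<le> \<bar>X x - 0\<bar>" if "x \<in> space M" for x
    using assms(1)[OF that] assms(2) by simp
  then have "{x\<in>space M. e \<le> \<bar>X x - 0\<bar>} = {}" by blast
  then show ?thesis by (simp only: measure_empty)
qed

text \<open>This is \<open>VaR_near\<close> with centre 0. At level \<open>B\<close> the deviation
  event may carry mass, at \<open>B + e\<close> it is empty; hence the slack
  \<open>e\<close>.\<close>

lemma VaR_bounded:
  assumes "prob_space M" "X \<in> borel_measurable M" "0 < r" "r < 1"
    and bound: "\<And>x. x \<in> space M \<Longrightarrow> \<bar>X x\<bar> \<le> B"
  shows "\<bar>VaR r M X\<bar> \<le> B"
proof (rule field_le_epsilon)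
  fix e :: real assume e: "0 < e"
  have B: "0 \<le> B" using prob_space.bound_nonneg[OF assms(1), of X B] bound by blast
  have "\<bar>VaR r M X - 0\<bar> \<le> B + e"
  proof (rule VaR_near[OF assms(1-4)])
    show "measure M {x\<in>space M. B + e \<le> \<bar>X x - 0\<bar>} < min r (1 - r)"
      using e assms(3,4) by (subst measure_deviation_eq_0[OF bound]) auto
  qed (use B e in linarith)
  then show "\<bar>VaR r M X\<bar> \<le> B + e" by simp
qed

text \<open>Monotonicity in the level makes the integrand of \<open>CVaR\<close> Borel
  measurable.\<close>

lemma VaR_mono_on:
  assumes "prob_space M" "X \<in> borel_measurable M"
    and bound: "\<And>x. x \<in> space M \<Longrightarrow> \<bar>X x\<bar> \<le> B"
  shows "mono_on {0<..<1} (\<lambda>r. VaR r M X)"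
proof (rule mono_onI)
  fix r s :: real assume rs: "r \<in> {0<..<1}" "s \<in> {0<..<1}" "r \<le> s"
  \<comment> \<open>Any level above \<open>B\<close> would do: the event is then empty and the bound
    holds for all \<open>q\<close> at once.\<close>
  have dev: "measure M {x\<in>space M. B + 1 \<le> \<bar>X x - 0\<bar>} < min q (1 - q)" if "q \<in> {0<..<1}" for q
    using that by (subst measure_deviation_eq_0[OF bound]) auto
  have "0 \<le> B" using prob_space.bound_nonneg[OF assms(1), of X B] bound by blast
  then have B: "0 \<le> B + 1" by simp
  show "VaR r M X \<le> VaR s M X"
    unfolding VaR_def
  proof (rule cInf_superset_mono)
    show "{t. s \<le> measure M {x\<in>space M. X x \<le> t}} \<noteq> {}"
      using VaR_set_bounds(1)[OF assms(1,2) _ _ dev B, of s] rs by auto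
    show "bdd_below {t. r \<le> measure M {x\<in>space M. X x \<le> t}}"
      using VaR_set_bounds(2)[OF assms(1,2) _ _ dev B, of r] rs
      by (intro bdd_belowI[of _ "0 - (B + 1)"]) auto
  qed (use rs in auto)
qed

lemma VaR_tendsto:
  fixes Q :: "nat \<Rightarrow> 'a measure"
  assumes Q: "\<And>n. prob_space (Q n)"
    and X: "\<And>n. X \<in> borel_measurable (Q n)"
    and conv: "\<And>e. 0 < e \<Longrightarrow> (\<lambda>n. measure (Q n) {x\<in>space (Q n). e \<le> \<bar>X x - c\<bar>}) \<longlonglongrightarrow> 0"
    and r: "0 < r" "r < 1"
  shows "(\<lambda>n. VaR r (Q n) X) \<longlonglongrightarrow> c"
proof (rule tendstoI)
  fix e :: real assume e: "0 < e"
  have "0 < min r (1 - r)" using r by simp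
  with conv[of "e / 2"] e
  have "\<forall>\<^sub>F n in sequentially. measure (Q n) {x\<in>space (Q n). e / 2 \<le> \<bar>X x - c\<bar>} < min r (1 - r)"
    by (intro order_tendstoD) auto
  then show "\<forall>\<^sub>F n in sequentially. dist (VaR r (Q n) X) c < e"
  proof eventually_elim
    case (elim n)
    from VaR_near[OF Q X r elim] e show ?case by (simp add: dist_real_def)
  qed
qed

text \<open>Dominated convergence is applied in the level \<open>r\<close>, with respect to Lebesgue
  measure and with constant bound \<open>B\<close>; the changing measures \<open>Q n\<close> enter
  only through the values of \<open>VaR\<close>.\<close>

lemma CVaR_tendsto:
  fixes Q :: "nat \<Rightarrow> 'a measure"
  assumes Q: "\<And>n. prob_space (Q n)"
    and X: "\<And>n. X \<in> borel_measurable (Q n)"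
    and bound: "\<And>n x. x \<in> space (Q n) \<Longrightarrow> \<bar>X x\<bar> \<le> B"
    and conv: "\<And>e. 0 < e \<Longrightarrow> (\<lambda>n. measure (Q n) {x\<in>space (Q n). e \<le> \<bar>X x - c\<bar>}) \<longlonglongrightarrow> 0"
    and a: "0 < a" "a < 1"
  shows "(\<lambda>n. CVaR a (Q n) X) \<longlonglongrightarrow> c"
proof -
  have "(\<lambda>n. LINT r:{a<..<1}|lborel. VaR r (Q n) X) \<longlonglongrightarrow> (LINT r:{a<..<1}|lborel. c)"
    unfolding set_lebesgue_integral_def
  proof (rule integral_dominated_convergence[where w = "\<lambda>r. B * indicator {a<..<1} r"])
    show "(\<lambda>r. indicator {a<..<1} r *\<^sub>R VaR r (Q n) X) \<in> borel_measurable lborel" for n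
    proof -
      have "mono_on {a<..<1} (\<lambda>r. VaR r (Q n) X)"
        using VaR_mono_on[OF Q X bound] a by (auto simp: mono_on_def)
      from borel_measurable_mono_on_fnc[OF this] show ?thesis
        by (subst (asm) borel_measurable_restrict_space_iff) (auto simp: mult.commute)
    qed
    show "integrable lborel (\<lambda>r. B * indicator {a<..<1} r)"
      using a by (intro integrable_mult_right integrable_real_indicator) auto
    show "AE r in lborel. (\<lambda>n. indicator {a<..<1} r *\<^sub>R VaR r (Q n) X) \<longlonglongrightarrow> indicator {a<..<1} r *\<^sub>R c"
      using VaR_tendsto[OF Q X conv] a
      by (intro AE_I2) (auto simp: indicator_def)
    show "AE r in lborel. norm (indicator {a<..<1} r *\<^sub>R VaR r (Q n) X) \<le> B * indicator {a<..<1} r" for n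
      using VaR_bounded[OF Q X _ _ bound] a
      by (intro AE_I2) (auto simp: indicator_def)
  qed simp
  moreover have "(LINT r:{a<..<1}|lborel. c) = (1 - a) * c"
    unfolding set_lebesgue_integral_def using a by simp
  ultimately have "(\<lambda>n. 1 / (1 - a) * (LINT r:{a<..<1}|lborel. VaR r (Q n) X)) \<longlonglongrightarrow> 1 / (1 - a) * ((1 - a) * c)"
    by (intro tendsto_mult_left) simp
  then show ?thesis
    using a by (simp add: CVaR_def)
qed

lemma mean_risk_tendsto:
  fixes Q :: "nat \<Rightarrow> 'a measure"
  assumes Q: "\<And>n. prob_space (Q n)"
    and X[measurable]: "\<And>n. X \<in> borel_measurable (Q n)"
    and bound: "\<And>n x. x \<in> space (Q n) \<Longrightarrow> \<bar>X x\<bar> \<le> B"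
    and conv: "\<And>e. 0 < e \<Longrightarrow> (\<lambda>n. measure (Q n) {x\<in>space (Q n). e \<le> \<bar>X x - c\<bar>}) \<longlonglongrightarrow> 0"
  shows "(\<lambda>n. mean_risk (Q n) X) \<longlonglongrightarrow> c"
proof -
  have int: "integrable (Q n) X" for n
    by (rule finite_measure.integrable_const_bound[OF prob_space.finite_measure[OF Q] AE_I2 X, of n B])
       (use bound in simp)
  have "(\<lambda>n. \<integral>x. \<bar>X x - c\<bar> \<partial>Q n) \<longlonglongrightarrow> 0"
  proof (rule expectation_tendsto_0[where K = "B + \<bar>c\<bar>"])
    fix n x assume "x \<in> space (Q n)"
    then show "0 \<le> \<bar>X x - c\<bar> \<and> \<bar>X x - c\<bar> \<le> B + \<bar>c\<bar>" using bound[of x n] by linarith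
  qed (rule Q, measurable, rule conv)
  moreover have "norm (mean_risk (Q n) X - c) \<le> (\<integral>x. \<bar>X x - c\<bar> \<partial>Q n)" for n
  proof -
    interpret prob_space "Q n" by (rule Q)
    have "mean_risk (Q n) X - c = (\<integral>x. X x - c \<partial>Q n)"
      using int by (simp add: mean_risk_def prob_space)
    then show ?thesis using integral_abs_bound[of "Q n" "\<lambda>x. X x - c"] by simp
  qed
  ultimately have "(\<lambda>n. mean_risk (Q n) X - c) \<longlonglongrightarrow> 0"
    by (rule Lim_null_comparison[OF always_eventually[OF allI], rotated])
  then show ?thesis by (simp add: LIM_zero_iff)
qed

text \<open>The mean moves with n, so the second moment about the fixed limit \<open>c\<close> is
  estimated; it exceeds the variance by the squared bias.\<close>

lemma variance_tendsto_0:
  fixes Q :: "nat \<Rightarrow> 'a measure" and X :: "'a \<Rightarrow> real"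
  assumes Q: "\<And>n. prob_space (Q n)"
    and X[measurable]: "\<And>n. X \<in> borel_measurable (Q n)"
    and bound: "\<And>n x. x \<in> space (Q n) \<Longrightarrow> \<bar>X x\<bar> \<le> B"
    and conv: "\<And>e. 0 < e \<Longrightarrow> (\<lambda>n. measure (Q n) {x\<in>space (Q n). e \<le> \<bar>X x - c\<bar>}) \<longlonglongrightarrow> 0"
  shows "(\<lambda>n. prob_space.variance (Q n) X) \<longlonglongrightarrow> 0"
proof -
  have "(\<lambda>n. \<integral>x. (X x - c)\<^sup>2 \<partial>Q n) \<longlonglongrightarrow> 0"
  proof (rule expectation_tendsto_0[where K = "(B + \<bar>c\<bar>)\<^sup>2"])
    fix e :: real assume e: "0 < e"
    have "{x\<in>space (Q n). e \<le> (X x - c)\<^sup>2} = {x\<in>space (Q n). sqrt e \<le> \<bar>X x - c\<bar>}" for n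
      by (metis (no_types) real_sqrt_abs real_sqrt_le_iff)
    with conv[of "sqrt e"] e show "(\<lambda>n. measure (Q n) {x\<in>space (Q n). e \<le> (X x - c)\<^sup>2}) \<longlonglongrightarrow> 0"
      by simp
  next
    fix n x assume "x \<in> space (Q n)"
    then have "\<bar>X x - c\<bar> \<le> B + \<bar>c\<bar>" using bound[of x n] by linarith
    then have "\<bar>X x - c\<bar>\<^sup>2 \<le> (B + \<bar>c\<bar>)\<^sup>2" by (intro power_mono) auto
    then show "0 \<le> (X x - c)\<^sup>2 \<and> (X x - c)\<^sup>2 \<le> (B + \<bar>c\<bar>)\<^sup>2" by simp
  qed (use Q in auto)
  moreover have "norm (prob_space.variance (Q n) X) \<le> (\<integral>x. (X x - c)\<^sup>2 \<partial>Q n)" for n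
  proof -
    interpret prob_space "Q n" by (rule Q)
    have int: "integrable (Q n) X"
      by (rule integrable_const_bound[of _ B]) (use bound in auto)
    have "\<bar>X x * X x\<bar> \<le> B * B" if "x \<in> space (Q n)" for x
      using bound[OF that] unfolding abs_mult by (intro mult_mono) auto
    then have int2: "integrable (Q n) (\<lambda>x. (X x)\<^sup>2)"
      unfolding power2_eq_square
      by (intro integrable_const_bound[of _ "B * B"]) auto
    have "(\<integral>x. (X x - c)\<^sup>2 \<partial>Q n) = variance X + (expectation X - c)\<^sup>2"
      using int int2
      by (simp add: variance_eq power2_diff prob_space) (simp add: power2_eq_square)
    then show ?thesis using variance_positive[of X] by simp
  qed
  ultimately show ?thesis
    by (rule Lim_null_comparison[OF always_eventually[OF allI], rotated])
qed

text \<open>The preceding lemmas ask for probability measures at every index. They are applied to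
  the sequence shifted by \<open>N\<close>, and \<open>LIMSEQ_offset\<close> removes the
  shift.\<close>

lemma risks_tendsto:
  fixes Q :: "nat \<Rightarrow> 'a measure"
  assumes Q: "\<forall>\<^sub>F n in sequentially. prob_space (Q n)"
    and X: "\<And>n. X \<in> borel_measurable (Q n)"
    and bound: "\<And>n x. x \<in> space (Q n) \<Longrightarrow> \<bar>X x\<bar> \<le> B"
    and conv: "\<And>e. 0 < e \<Longrightarrow> (\<lambda>n. measure (Q n) {x\<in>space (Q n). e \<le> \<bar>X x - c\<bar>}) \<longlonglongrightarrow> 0"
  shows "(\<lambda>n. mean_risk (Q n) X) \<longlonglongrightarrow> c"
    and "(\<lambda>n. mean_variance_risk w (Q n) X) \<longlonglongrightarrow> c"
    and "0 < a \<Longrightarrow> a < 1 \<Longrightarrow> (\<lambda>n. VaR a (Q n) X) \<longlonglongrightarrow> c"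
    and "0 < a \<Longrightarrow> a < 1 \<Longrightarrow> (\<lambda>n. CVaR a (Q n) X) \<longlonglongrightarrow> c"
proof -
  obtain N where N: "\<And>n. prob_space (Q (n + N))"
    using Q unfolding eventually_sequentially by (metis le_add2)
  have conv': "0 < e \<Longrightarrow> (\<lambda>n. measure (Q (n + N)) {x\<in>space (Q (n + N)). e \<le> \<bar>X x - c\<bar>}) \<longlonglongrightarrow> 0" for e
    by (rule LIMSEQ_ignore_initial_segment[OF conv])
  have mean: "(\<lambda>n. mean_risk (Q (n + N)) X) \<longlonglongrightarrow> c"
    by (rule mean_risk_tendsto[OF N X bound conv'])
  have var: "(\<lambda>n. prob_space.variance (Q (n + N)) X) \<longlonglongrightarrow> 0"
    by (rule variance_tendsto_0[OF N X bound conv'])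
  have mean_var: "(\<lambda>n. mean_variance_risk w (Q (n + N)) X) \<longlonglongrightarrow> c"
    using tendsto_add[OF mean tendsto_mult_right_zero[OF var, of w]]
    by (simp add: mean_variance_risk_def mean_risk_def)
  show "(\<lambda>n. mean_risk (Q n) X) \<longlonglongrightarrow> c" by (rule LIMSEQ_offset[OF mean])
  show "(\<lambda>n. mean_variance_risk w (Q n) X) \<longlonglongrightarrow> c" by (rule LIMSEQ_offset[OF mean_var])
  show "0 < a \<Longrightarrow> a < 1 \<Longrightarrow> (\<lambda>n. VaR a (Q n) X) \<longlonglongrightarrow> c"
    by (rule LIMSEQ_offset[OF VaR_tendsto[OF N X conv']])
  show "0 < a \<Longrightarrow> a < 1 \<Longrightarrow> (\<lambda>n. CVaR a (Q n) X) \<longlonglongrightarrow> c"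
    by (rule LIMSEQ_offset[OF CVaR_tendsto[OF N X bound conv']])
qed

section \<open>Sums of independent variables with negative mean\<close>

lemma (in prob_space) sequence_spaceI: "sequence_space M"
  by (simp add: sequence_space_def product_prob_space_def product_sigma_finite_def
    product_prob_space_axioms_def prob_space_axioms sigma_finite_measure_axioms)

text \<open>The range \<open>{..n}\<close> includes the empty sum, so the maximum is never negative;
  this is the source of the \<open>max 0\<close> in the recursion for a prepended sample.\<close>

definition max_partial_sum :: "('a \<Rightarrow> real) \<Rightarrow> nat \<Rightarrow> (nat \<Rightarrow> 'a) \<Rightarrow> real" where
  "max_partial_sum f n \<omega> = Max ((\<lambda>m. \<Sum>i<m. f (\<omega> i)) ` {..n})"

lemma max_partial_sum_0: "max_partial_sum f 0 \<omega> = 0"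
  by (simp add: max_partial_sum_def)

lemma max_partial_sum_mono: "m \<le> n \<Longrightarrow> max_partial_sum f m \<omega> \<le> max_partial_sum f n \<omega>"
  unfolding max_partial_sum_def by (intro Max_mono) auto

lemma max_partial_sum_nonneg: "0 \<le> max_partial_sum f n \<omega>"
  using max_partial_sum_mono[of 0 n f \<omega>] by (simp add: max_partial_sum_0)

lemma sum_le_max_partial_sum: "(\<Sum>i<n. f (\<omega> i)) \<le> max_partial_sum f n \<omega>"
  unfolding max_partial_sum_def by (intro Max_ge) auto

text \<open>Every nonempty partial sum of the prolonged sequence is \<open>f s\<close> plus a
  partial sum of \<open>\<omega>\<close>. The shift is expressed by prepending a sample, the form in
  which the infinite product measure decomposes.\<close>

lemma max_partial_sum_Suc:
  "max_partial_sum f (Suc n) (case_nat s \<omega>) = max 0 (f s + max_partial_sum f n \<omega>)"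
proof -
  have "max_partial_sum f (Suc n) (case_nat s \<omega>) =
    Max (insert 0 ((\<lambda>m. f s + (\<Sum>i<m. f (\<omega> i))) ` {..n}))"
    unfolding max_partial_sum_def atMost_Suc_eq_insert_0
    by (simp add: image_image sum.lessThan_Suc_shift del: sum.lessThan_Suc)
  also have "\<dots> = max 0 (Max ((\<lambda>m. f s + (\<Sum>i<m. f (\<omega> i))) ` {..n}))"
    by (intro Max_insert) auto
  also have "Max ((\<lambda>m. f s + (\<Sum>i<m. f (\<omega> i))) ` {..n}) = f s + max_partial_sum f n \<omega>"
    unfolding max_partial_sum_def
    using Max_add_commute[of "{..n}" "\<lambda>m. \<Sum>i<m. f (\<omega> i)" "f s"] by (simp add: add.commute)
  finally show ?thesis .
qed

text \<open>Form for the measurability induction: the new maximum is a case distinction on a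
  measurable comparison with the old one.\<close>

lemma max_partial_sum_rec:
  "max_partial_sum f (Suc n) \<omega> =
    (if 0 < (\<Sum>i<Suc n. f (\<omega> i)) - max_partial_sum f n \<omega> then \<Sum>i<Suc n. f (\<omega> i) else max_partial_sum f n \<omega>)"
proof -
  have "max_partial_sum f (Suc n) \<omega> = max (\<Sum>i<Suc n. f (\<omega> i)) (max_partial_sum f n \<omega>)"
    unfolding max_partial_sum_def atMost_Suc image_insert by (rule Max_insert) auto
  then show ?thesis by (simp add: max_def)
qed

lemma measurable_max_partial_sum [measurable]:
  assumes [measurable]: "f \<in> borel_measurable M"
  shows "max_partial_sum f n \<in> borel_measurable (prod_inf M)"
proof (induction n)
  case 0 then show ?case by (simp add: max_partial_sum_0 cong: measurable_cong)
next
  case (Suc n)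
  note [measurable] = Suc
  show ?case unfolding max_partial_sum_rec by measurable
qed

lemma (in pair_sigma_finite)
  fixes f g :: "_ \<Rightarrow> real"
  assumes f: "integrable M1 f" and g: "integrable M2 g"
  shows integrable_mult_pair: "integrable (M1 \<Otimes>\<^sub>M M2) (\<lambda>z. f (fst z) * g (snd z))"
    and integral_mult_pair:
      "(\<integral>z. f (fst z) * g (snd z) \<partial>(M1 \<Otimes>\<^sub>M M2)) = (\<integral>x. f x \<partial>M1) * (\<integral>y. g y \<partial>M2)"
proof -
  have [measurable]: "f \<in> borel_measurable M1" "g \<in> borel_measurable M2" using f g by auto
  show int: "integrable (M1 \<Otimes>\<^sub>M M2) (\<lambda>z. f (fst z) * g (snd z))"
  proof (rule Fubini_integrable)
    show "integrable M1 (\<lambda>x. \<integral>y. norm (f (fst (x, y)) * g (snd (x, y))) \<partial>M2)"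
      using f by (simp add: abs_mult)
    show "AE x in M1. integrable M2 (\<lambda>y. f (fst (x, y)) * g (snd (x, y)))"
      using g by simp
  qed measurable
  show "(\<integral>z. f (fst z) * g (snd z) \<partial>(M1 \<Otimes>\<^sub>M M2)) = (\<integral>x. f x \<partial>M1) * (\<integral>y. g y \<partial>M2)"
    using integral_fst'[OF int] by simp
qed

text \<open>The maximum lies below the sum of the absolute values. Finite integrals are needed
  because Garsia's argument subtracts them.\<close>

lemma integrable_max_partial_sum:
  assumes M: "prob_space M" and f: "integrable M f"
  shows "integrable (prod_inf M) (max_partial_sum f n)"
proof -
  interpret prob_space M by fact
  interpret sequence_space M by (rule sequence_spaceI)
  have [measurable]: "f \<in> borel_measurable M" using f by simp
  have int: "integrable S (\<lambda>\<omega>. f (\<omega> i))" for i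
    by (subst integrable_distr_eq[of "\<lambda>\<omega>. \<omega> i" S M f, symmetric])
       (simp_all add: f distr_PiM_component[of UNIV "\<lambda>_. M" i] M)
  show ?thesis
  proof (rule Bochner_Integration.integrable_bound)
    show "integrable S (\<lambda>\<omega>. \<Sum>i<n. \<bar>f (\<omega> i)\<bar>)"
      using int by auto
    show "AE \<omega> in S. norm (max_partial_sum f n \<omega>) \<le> norm (\<Sum>i<n. \<bar>f (\<omega> i)\<bar>)"
    proof (intro AE_I2)
      fix \<omega>
      have "max_partial_sum f n \<omega> \<le> (\<Sum>i<n. \<bar>f (\<omega> i)\<bar>)"
        unfolding max_partial_sum_def
      proof (rule Max.boundedI)
        fix a assume "a \<in> (\<lambda>m. \<Sum>i<m. f (\<omega> i)) ` {..n}"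
        then obtain m where "m \<le> n" "a = (\<Sum>i<m. f (\<omega> i))" by auto
        then have "a \<le> (\<Sum>i<m. \<bar>f (\<omega> i)\<bar>)" by (auto intro: sum_mono)
        also have "\<dots> \<le> (\<Sum>i<n. \<bar>f (\<omega> i)\<bar>)" using \<open>m \<le> n\<close> by (intro sum_mono2) auto
        finally show "a \<le> (\<Sum>i<n. \<bar>f (\<omega> i)\<bar>)" .
      qed auto
      then show "norm (max_partial_sum f n \<omega>) \<le> norm (\<Sum>i<n. \<bar>f (\<omega> i)\<bar>)"
        using max_partial_sum_nonneg[of f n \<omega>] by simp
    qed
  qed measurable
qed

text \<open>Garsia's argument: on the shift-invariant event that the partial sums are unbounded, the
  running maxima \<open>M\<^sub>n\<close> satisfy \<open>M\<^sub>n\<^sub>+\<^sub>1 - M\<^sub>n \<circ> shift = max (- M\<^sub>n \<circ> shift) f \<rightarrow> f\<close>. The integral of the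
  left-hand side over the event is nonnegative, and that of \<open>f\<close> is the probability of the
  event times the mean of \<open>f\<close>.\<close>

lemma AE_partial_sums_bounded:
  fixes f :: "'a \<Rightarrow> real"
  assumes M: "prob_space M" and f: "integrable M f" and neg: "(\<integral>x. f x \<partial>M) < 0"
  shows "AE \<omega> in prod_inf M. \<exists>C. \<forall>n. (\<Sum>i<n. f (\<omega> i)) \<le> C"
proof -
  interpret prob_space M by fact
  note integrable_const' = integrable_const and prob_space_M = prob_space
  interpret sequence_space M by (rule sequence_spaceI)
  interpret pair: pair_prob_space M S ..
  have f_meas[measurable]: "f \<in> borel_measurable M" using f by simp
  let ?m = "max_partial_sum f"
  \<comment> \<open>Natural numbers as bounds keep the event a countable combination of measurable
    sets.\<close>
  define A where "A = {\<omega>\<in>space S. \<forall>C::nat. \<exists>n. real C \<le> ?m n \<omega>}"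
  have [measurable]: "A \<in> sets S" unfolding A_def by measurable
  \<comment> \<open>Prepending one sample moves the maxima by a finite amount depending on
    \<open>f s\<close>, which cannot change whether they are unbounded.\<close>
  have shift: "case_nat s \<omega> \<in> A \<longleftrightarrow> \<omega> \<in> A" if "s \<in> space M" "\<omega> \<in> space S" for s \<omega>
  proof -
    have sp: "case_nat s \<omega> \<in> space S"
      using that by (auto simp: space_PiM PiE_iff split: nat.split)
    show ?thesis
    proof
      assume A: "case_nat s \<omega> \<in> A"
      have "\<exists>n. real C \<le> ?m n \<omega>" for C :: nat
      proof -
        obtain D :: nat where D: "max 0 (f s) + real C + 1 \<le> real D" using real_arch_simple by blast
        obtain n where n: "real D \<le> ?m n (case_nat s \<omega>)" using A unfolding A_def by auto
        have "real C \<le> ?m n \<omega>"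
          using order_trans[OF n max_partial_sum_mono[of n "Suc n"]] D
          by (simp add: max_partial_sum_Suc)
        then show ?thesis ..
      qed
      then show "\<omega> \<in> A" using that by (simp add: A_def)
    next
      assume A: "\<omega> \<in> A"
      have "\<exists>n. real C \<le> ?m n (case_nat s \<omega>)" for C :: nat
      proof -
        obtain D :: nat where D: "real C - f s \<le> real D" using real_arch_simple by blast
        obtain n where n: "real D \<le> ?m n \<omega>" using A unfolding A_def by auto
        have "real C \<le> ?m (Suc n) (case_nat s \<omega>)"
          using n D by (simp add: max_partial_sum_Suc)
        then show ?thesis ..
      qed
      then show "case_nat s \<omega> \<in> A" using sp by (simp add: A_def)
    qed
  qed
  \<comment> \<open>Here \<open>fst z\<close> is the first sample and \<open>snd z\<close> the
    sequence left by the shift.\<close>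
  define g where "g n z = indicator A (snd z) * max (- ?m n (snd z)) (f (fst z))" for n z
  have int_m: "integrable S (\<lambda>\<omega>. indicator A \<omega> * ?m n \<omega>)" for n
    using integrable_mult_indicator[OF _ integrable_max_partial_sum[OF M f], of A n] by simp
  have [measurable]: "(\<lambda>(s, \<omega>). case_nat s \<omega>) \<in> M \<Otimes>\<^sub>M S \<rightarrow>\<^sub>M S" by measurable
  have int_shift: "integrable (M \<Otimes>\<^sub>M S) (\<lambda>(s, \<omega>). indicator A (case_nat s \<omega>) * ?m n (case_nat s \<omega>))" for n
    using int_m[of n] by (subst (asm) PiM_iter[symmetric], subst (asm) integrable_distr_eq)
      (auto simp: split_beta')
  have int_snd: "integrable (M \<Otimes>\<^sub>M S) (\<lambda>(s, \<omega>). indicator A \<omega> * ?m n \<omega>)" for n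
    using pair.integrable_mult_pair[OF integrable_const' int_m, of 1 n] by (simp add: split_beta')
  \<comment> \<open>Prepending an independent sample preserves the law and \<open>A\<close>, so the
    integral is that of \<open>?m (Suc n) - ?m n\<close> over \<open>A\<close>, which is nonnegative
    because the maxima grow with n.\<close>
  have pos: "0 \<le> (\<integral>z. g n z \<partial>(M \<Otimes>\<^sub>M S))" for n
  proof -
    have "(\<integral>z. g n z \<partial>(M \<Otimes>\<^sub>M S)) = (\<integral>z. (case z of (s, \<omega>) \<Rightarrow> indicator A (case_nat s \<omega>) * ?m (Suc n) (case_nat s \<omega>))
        - (case z of (s, \<omega>) \<Rightarrow> indicator A \<omega> * ?m n \<omega>) \<partial>(M \<Otimes>\<^sub>M S))"
      by (intro Bochner_Integration.integral_cong)
         (auto simp: g_def space_pair_measure shift max_partial_sum_Suc indicator_def)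
    also have "\<dots> = (\<integral>\<omega>. indicator A \<omega> * ?m (Suc n) \<omega> \<partial>S) - (\<integral>\<omega>. indicator A \<omega> * ?m n \<omega> \<partial>S)"
      using int_shift[of "Suc n"] int_snd[of n]
        pair.integral_mult_pair[OF integrable_const' int_m, of 1 n]
      by (subst PiM_iter[symmetric], subst integral_distr)
         (auto simp: split_beta' prob_space_M)
    also have "0 \<le> \<dots>"
      using integral_mono[OF int_m int_m, of n "Suc n"] max_partial_sum_mono[of n "Suc n" f]
      by (auto simp: indicator_def)
    finally show ?thesis .
  qed
  have lim: "(\<lambda>n. \<integral>z. g n z \<partial>(M \<Otimes>\<^sub>M S)) \<longlonglongrightarrow> (\<integral>z. indicator A (snd z) * f (fst z) \<partial>(M \<Otimes>\<^sub>M S))"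
  \<comment> \<open>Since \<open>?m n\<close> is nonnegative, \<open>max (- ?m n) y\<close> equals
    \<open>y\<close> for nonnegative \<open>y\<close> and lies between \<open>y\<close> and 0
    otherwise.\<close>
  proof (rule integral_dominated_convergence[where w = "\<lambda>z. \<bar>f (fst z)\<bar>"])
    show "integrable (M \<Otimes>\<^sub>M S) (\<lambda>z. \<bar>f (fst z)\<bar>)"
      using pair.integrable_mult_pair[OF integrable_abs[OF f] P.integrable_const, of 1] by simp
    show "AE z in M \<Otimes>\<^sub>M S. (\<lambda>n. g n z) \<longlonglongrightarrow> indicator A (snd z) * f (fst z)"
    proof (intro AE_I2 tendsto_eventually)
      fix z
      show "\<forall>\<^sub>F n in sequentially. g n z = indicator A (snd z) * f (fst z)"
      proof (cases "snd z \<in> A")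
        case True
        obtain D :: nat where D: "- f (fst z) \<le> real D" using real_arch_simple by blast
        obtain N where N: "real D \<le> ?m N (snd z)" using True unfolding A_def by auto
        have "g n z = indicator A (snd z) * f (fst z)" if "N \<le> n" for n
          using N D max_partial_sum_mono[OF that, of f "snd z"] by (simp add: g_def max_def)
        then show ?thesis unfolding eventually_sequentially by blast
      qed (simp add: g_def)
    qed
    show "AE z in M \<Otimes>\<^sub>M S. norm (g n z) \<le> \<bar>f (fst z)\<bar>" for n
    proof (intro AE_I2)
      fix z
      show "norm (g n z) \<le> \<bar>f (fst z)\<bar>"
        using max_partial_sum_nonneg[of f n "snd z"] by (cases "snd z \<in> A") (auto simp: g_def max_def)
    qed
  qed (auto simp: g_def)
  \<comment> \<open>The event concerns only the shifted sequence and \<open>f\<close> only the first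
    sample, so the limit factorises; with a negative mean it can be nonnegative only if
    \<open>A\<close> is null.\<close>
  have "(\<integral>z. indicator A (snd z) * f (fst z) \<partial>(M \<Otimes>\<^sub>M S)) = P.prob A * (\<integral>x. f x \<partial>M)"
    using pair.integral_mult_pair[OF f integrable_real_indicator, of A]
    by (simp add: mult.commute[of "indicator _ _"] P.emeasure_eq_measure)
  with LIMSEQ_le_const[OF lim, of 0] pos have "0 \<le> P.prob A * (\<integral>x. f x \<partial>M)" by auto
  with neg have "P.prob A = 0"
    by (smt (verit) measure_nonneg mult_pos_neg)
  then have "AE \<omega> in S. \<omega> \<notin> A"
    by (simp add: AE_iff_measurable[of A] P.emeasure_eq_measure A_def sets.sets_into_space)
  then show ?thesis
  proof (rule AE_mp, intro AE_I2 impI)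
    fix \<omega> assume "\<omega> \<in> space S" "\<omega> \<notin> A"
    then obtain C :: nat where "\<And>n. ?m n \<omega> < real C" by (auto simp: A_def not_le)
    then show "\<exists>C. \<forall>n. (\<Sum>i<n. f (\<omega> i)) \<le> C"
      by (intro exI[of _ "real C"] allI order_trans[OF sum_le_max_partial_sum] less_imp_le)
  qed
qed

section \<open>Finite and infinite product measures\<close>

text \<open>The sum of the series has a finite integral, so it is finite almost everywhere and its
  terms tend to 0 there.\<close>

lemma AE_tendsto_0_if_geometric_nn_integral:
  fixes f :: "nat \<Rightarrow> 'a \<Rightarrow> ennreal"
  assumes [measurable]: "\<And>n. f n \<in> borel_measurable M"
    and le: "\<And>n. (\<integral>\<^sup>+x. f n x \<partial>M) \<le> ennreal (C * r ^ n)"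
    and r: "0 \<le> r" "r < 1" and C: "0 \<le> C"
  shows "AE x in M. (\<lambda>n. f n x) \<longlonglongrightarrow> 0"
proof -
  have "(\<integral>\<^sup>+x. (\<Sum>n. f n x) \<partial>M) = (\<Sum>n. \<integral>\<^sup>+x. f n x \<partial>M)"
    by (rule nn_integral_suminf) measurable
  also have "\<dots> \<le> (\<Sum>n. ennreal (C * r ^ n))"
    by (rule suminf_le) (use le in auto)
  also have "\<dots> = ennreal (\<Sum>n. C * r ^ n)"
    using r C by (intro suminf_ennreal2 summable_mult summable_geometric) auto
  finally have "(\<integral>\<^sup>+x. (\<Sum>n. f n x) \<partial>M) \<noteq> \<infinity>"
    by (auto simp: top_unique)
  then have "AE x in M. (\<Sum>n. f n x) \<noteq> \<infinity>"
    by (rule nn_integral_PInf_AE[rotated]) measurable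
  then show ?thesis
  proof eventually_elim
    case (elim x)
    have fin: "f n x \<noteq> \<infinity>" for n
      using elim sum_le_suminf[OF summableI, of "{n}" "\<lambda>n. f n x"] by (auto simp: top_unique)
    define g where "g n = enn2real (f n x)" for n
    have g: "f n x = ennreal (g n)" for n
      using fin[of n] by (simp add: g_def less_top)
    have "summable g"
      by (rule summable_suminf_not_top) (simp add: g_def, use elim in \<open>simp flip: g\<close>)
    then have "g \<longlonglongrightarrow> 0" by (rule summable_LIMSEQ_zero)
    then have "(\<lambda>n. ennreal (g n)) \<longlonglongrightarrow> ennreal 0" by (rule tendsto_ennrealI)
    then show ?case by (simp add: g)
  qed
qed

lemma distr_prod_inf_restrict:
  assumes "prob_space M"
  shows "distr (prod_inf M) (prod_n n M) (\<lambda>\<omega>. restrict \<omega> {..<n}) = prod_n n M"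
proof -
  interpret prob_space M by fact
  interpret sequence_space M by (rule sequence_spaceI)
  show ?thesis by (rule distr_PiM_restrict_finite) auto
qed

lemma nn_integral_prod_inf_restrict:
  assumes "prob_space M" "f \<in> borel_measurable (prod_n n M)"
  shows "(\<integral>\<^sup>+\<omega>. f (restrict \<omega> {..<n}) \<partial>prod_inf M) = (\<integral>\<^sup>+\<xi>. f \<xi> \<partial>prod_n n M)"
proof -
  have [measurable]: "(\<lambda>\<omega>. restrict \<omega> {..<n}) \<in> prod_inf M \<rightarrow>\<^sub>M prod_n n M"
    by (rule measurable_restrict_subset) auto
  show ?thesis
    using assms(2) by (subst (1) distr_prod_inf_restrict[OF assms(1), symmetric])
      (simp add: nn_integral_distr)
qed

lemma AE_prod_inf_restrict:
  assumes "prob_space M" "AE \<xi> in prod_n n M. Q \<xi>"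
  shows "AE \<omega> in prod_inf M. Q (restrict \<omega> {..<n})"
proof (rule AE_distrD[where M' = "prod_n n M"])
  show "(\<lambda>\<omega>. restrict \<omega> {..<n}) \<in> prod_inf M \<rightarrow>\<^sub>M prod_n n M"
    by (rule measurable_restrict_subset) auto
qed (simp only: distr_prod_inf_restrict[OF assms(1)] assms(2))

lemma measurable_block [measurable]:
  "(\<lambda>\<omega>. \<lambda>i\<in>{..<k}. \<omega> (m + i)) \<in> prod_inf M \<rightarrow>\<^sub>M prod_n k M"
  by (rule measurable_restrict) measurable

text \<open>Disjoint blocks are independent. The induction peels off the first one:
  \<open>comb_seq k\<close> puts an independent sequence behind the first \<open>k\<close> samples,
  and block \<open>Suc j\<close> of the result is block \<open>j\<close> of that sequence.\<close>

lemma nn_integral_prod_blocks: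
  fixes f :: "(nat \<Rightarrow> 'a) \<Rightarrow> ennreal"
  assumes M: "prob_space M" and [measurable]: "f \<in> borel_measurable (prod_n k M)"
  shows "(\<integral>\<^sup>+\<omega>. (\<Prod>j<N. f (\<lambda>i\<in>{..<k}. \<omega> (j * k + i))) \<partial>prod_inf M) = (\<integral>\<^sup>+\<xi>. f \<xi> \<partial>prod_n k M) ^ N"
proof (induction N)
  case 0
  interpret prob_space "prod_inf M" by (intro prob_space_PiM M)
  show ?case by (simp add: emeasure_space_1)
next
  case (Suc N)
  interpret prob_space M by fact
  interpret sequence_space M by (rule sequence_spaceI)
  let ?F = "\<lambda>N \<omega>. \<Prod>j<N. f (\<lambda>i\<in>{..<k}. \<omega> (j * k + i))"
  have split: "?F (Suc N) (comb_seq k \<omega> \<omega>') = f (restrict \<omega> {..<k}) * ?F N \<omega>'" for \<omega> \<omega>'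
  proof -
    have "(\<lambda>i\<in>{..<k}. comb_seq k \<omega> \<omega>' (0 * k + i)) = restrict \<omega> {..<k}"
      by (auto simp: comb_seq_less fun_eq_iff)
    moreover have "(\<lambda>i\<in>{..<k}. comb_seq k \<omega> \<omega>' (Suc j * k + i)) = (\<lambda>i\<in>{..<k}. \<omega>' (j * k + i))" for j
      by (auto simp: fun_eq_iff comb_seq_def)
    ultimately show ?thesis
      by (simp only: prod.lessThan_Suc_shift)
  qed
  have [measurable]: "(\<lambda>\<omega>. restrict \<omega> {..<k}) \<in> S \<rightarrow>\<^sub>M prod_n k M"
    by (rule measurable_restrict_subset) auto
  have "(\<integral>\<^sup>+\<omega>. ?F (Suc N) \<omega> \<partial>S) = (\<integral>\<^sup>+z. ?F (Suc N) (comb_seq k (fst z) (snd z)) \<partial>(S \<Otimes>\<^sub>M S))"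
    by (subst PiM_comb_seq[of k, symmetric], subst nn_integral_distr) (auto simp: split_beta')
  also have "\<dots> = (\<integral>\<^sup>+\<omega>. \<integral>\<^sup>+\<omega>'. f (restrict \<omega> {..<k}) * ?F N \<omega>' \<partial>S \<partial>S)"
    unfolding split by (subst P.nn_integral_fst[symmetric]) auto
  also have "\<dots> = (\<integral>\<^sup>+\<omega>. f (restrict \<omega> {..<k}) \<partial>S) * (\<integral>\<^sup>+\<omega>'. ?F N \<omega>' \<partial>S)"
    by (simp add: nn_integral_cmult nn_integral_multc)
  also have "\<dots> = (\<integral>\<^sup>+\<xi>. f \<xi> \<partial>prod_n k M) ^ Suc N"
    by (simp add: Suc nn_integral_prod_inf_restrict M)
  finally show ?case .
qed

text \<open>Both sides agree on rectangles by Fubini's theorem. This lets a one-sample density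
  describe n samples as a product.\<close>

lemma PiM_density:
  assumes Q: "prob_space Q" and [measurable]: "g \<in> borel_measurable Q"
    and D: "prob_space (density Q g)" and I: "finite I"
  shows "(\<Pi>\<^sub>M i\<in>I. density Q g) = density (\<Pi>\<^sub>M i\<in>I. Q) (\<lambda>x. \<Prod>i\<in>I. g (x i))"
proof -
  interpret Q: product_sigma_finite "\<lambda>_. Q"
    using Q by (simp add: product_sigma_finite_def prob_space_imp_sigma_finite)
  interpret D: product_sigma_finite "\<lambda>_. density Q g"
    using D by (simp add: product_sigma_finite_def prob_space_imp_sigma_finite)
  show ?thesis
  proof (rule D.PiM_eqI[symmetric, OF I])
    show "sets (density (\<Pi>\<^sub>M i\<in>I. Q) (\<lambda>x. \<Prod>i\<in>I. g (x i))) = sets (\<Pi>\<^sub>M i\<in>I. density Q g)"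
      by (simp cong: sets_PiM_cong)
    fix A assume "\<And>i. i \<in> I \<Longrightarrow> A i \<in> sets (density Q g)"
    then have [measurable]: "\<And>i. i \<in> I \<Longrightarrow> A i \<in> sets Q" by simp
    have [measurable]: "Pi\<^sub>E I A \<in> sets (\<Pi>\<^sub>M i\<in>I. Q)"
      using I by (intro sets_PiM_I_finite) auto
    have "emeasure (density (\<Pi>\<^sub>M i\<in>I. Q) (\<lambda>x. \<Prod>i\<in>I. g (x i))) (Pi\<^sub>E I A)
        = (\<integral>\<^sup>+x. (\<Prod>i\<in>I. g (x i)) * indicator (Pi\<^sub>E I A) x \<partial>(\<Pi>\<^sub>M i\<in>I. Q))"
      by (rule emeasure_density) measurable
    also have "\<dots> = (\<integral>\<^sup>+x. (\<Prod>i\<in>I. g (x i) * indicator (A i) (x i)) \<partial>(\<Pi>\<^sub>M i\<in>I. Q))"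
      using I by (intro nn_integral_cong)
        (auto simp: prod.distrib indicator_def space_PiM PiE_iff)
    also have "\<dots> = (\<Prod>i\<in>I. \<integral>\<^sup>+x. g x * indicator (A i) x \<partial>Q)"
      using I by (subst Q.product_nn_integral_prod) auto
    also have "\<dots> = (\<Prod>i\<in>I. emeasure (density Q g) (A i))"
      by (intro prod.cong) (auto simp: emeasure_density)
    finally show "emeasure (density (\<Pi>\<^sub>M i\<in>I. Q) (\<lambda>x. \<Prod>i\<in>I. g (x i))) (Pi\<^sub>E I A) =
      (\<Prod>i\<in>I. emeasure (density Q g) (A i))" .
  qed
qed

section \<open>Concentration of the posterior\<close>

text \<open>A factor \<open>r\<close> per block of length \<open>k\<close> is a factor
  \<open>root k r\<close> per observation; rounding down in \<open>n div k\<close> loses at most one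
  factor \<open>r\<close>, hence the constant \<open>1 / r\<close>.\<close>

lemma power_div_le_geometric:
  fixes r :: real
  assumes r: "0 < r" "r < 1" and k: "1 \<le> k"
  obtains C s where "0 \<le> C" "0 \<le> s" "s < 1" "\<And>n. r ^ (n div k) \<le> C * s ^ n"
proof
  define s where "s = root k r"
  have s: "0 < s" "s < 1" "s ^ k = r" using r k by (auto simp: s_def)
  show "0 \<le> 1 / r" "0 \<le> s" "s < 1" using r s by auto
  fix n
  have "n \<le> k * (n div k) + k"
    using mod_less_divisor[of k n] k mult_div_mod_eq[of k n] by linarith
  then have "s ^ (k * (n div k) + k) \<le> s ^ n" using s by (intro power_decreasing) auto
  then have "r ^ (n div k) * r \<le> s ^ n" by (simp add: power_add power_mult s(3))
  then show "r ^ (n div k) \<le> 1 / r * s ^ n" using r by (simp add: field_simps)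
qed

text \<open>The statistical model without topology: \<open>space \<pi>\<close> is the parameter set
  and \<open>X\<close> carries the sample sigma-algebra. Nothing ties \<open>\<nu> n\<close> or
  \<open>p n\<close> to \<open>\<nu> 1\<close> or \<open>p 1\<close> except that both describe
  products of the same \<open>P \<theta>\<close>.\<close>

locale dominated_family =
  fixes \<pi> :: "'a measure" and X :: "'b measure" and P :: "'a \<Rightarrow> 'b measure" and \<theta>c :: 'a
    and \<nu> :: "nat \<Rightarrow> (nat \<Rightarrow> 'b) measure" and p :: "nat \<Rightarrow> 'a \<Rightarrow> (nat \<Rightarrow> 'b) \<Rightarrow> real"
  assumes prob_prior: "prob_space \<pi>"
    and prob_model: "\<theta> \<in> space \<pi> \<Longrightarrow> prob_space (P \<theta>)"
    and sets_model: "\<theta> \<in> space \<pi> \<Longrightarrow> sets (P \<theta>) = sets X"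
    and true_parameter: "\<theta>c \<in> space \<pi>"
    and sigma_finite_dominating: "1 \<le> n \<Longrightarrow> sigma_finite_measure (\<nu> n)"
    and sets_dominating: "1 \<le> n \<Longrightarrow> sets (\<nu> n) = sets (prod_n n X)"
    and density: "1 \<le> n \<Longrightarrow> \<theta> \<in> space \<pi> \<Longrightarrow>
      prod_n n (P \<theta>) = density (\<nu> n) (\<lambda>\<xi>. ennreal (p n \<theta> \<xi>))"
    and density_measurable: "1 \<le> n \<Longrightarrow>
      (\<lambda>(\<theta>, \<xi>). p n \<theta> \<xi>) \<in> borel_measurable (\<pi> \<Otimes>\<^sub>M prod_n n X)"
begin

abbreviation P0 :: "(nat \<Rightarrow> 'b) measure" where "P0 \<equiv> prod_inf (P \<theta>c)"

text \<open>Where the true density vanishes, division in \<open>ennreal\<close> yields 0 or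
  \<open>top\<close>; \<open>AE_true_density_pos\<close> shows that \<open>P0\<close> does not see
  these points.\<close>

definition likelihood_ratio :: "nat \<Rightarrow> 'a \<Rightarrow> (nat \<Rightarrow> 'b) \<Rightarrow> ennreal" where
  "likelihood_ratio n \<theta> \<omega> =
    ennreal (p n \<theta> (restrict \<omega> {..<n})) / ennreal (p n \<theta>c (restrict \<omega> {..<n}))"

lemma sets_P0 [measurable_cong]: "sets P0 = sets (prod_inf X)"
  by (intro sets_PiM_cong) (auto simp: sets_model true_parameter)

lemma sets_prod_n: "\<theta> \<in> space \<pi> \<Longrightarrow> sets (prod_n n (P \<theta>)) = sets (prod_n n X)"
  by (intro sets_PiM_cong) (auto simp: sets_model)

lemma prob_P0: "prob_space P0"
  by (intro prob_space_PiM prob_model true_parameter)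

sublocale prior: prob_space \<pi> by (rule prob_prior)
sublocale P0: prob_space P0 by (rule prob_P0)
sublocale prior_P0: pair_sigma_finite \<pi> P0 ..

lemma restrict_measurable [measurable]: "(\<lambda>\<omega>. restrict \<omega> {..<n}) \<in> prod_inf X \<rightarrow>\<^sub>M prod_n n X"
  by (rule measurable_restrict_subset) auto

lemma density_measurable' [measurable]:
  assumes "1 \<le> n" "\<theta> \<in> space \<pi>"
  shows "p n \<theta> \<in> borel_measurable (prod_n n X)"
  using measurable_Pair2[OF density_measurable[OF assms(1)] assms(2)] by simp

text \<open>Measurability is joint in parameter and data because prior and data integrals are
  exchanged later.\<close>

lemma likelihood_ratio_measurable:
  assumes n: "1 \<le> n"
  shows "(\<lambda>(\<theta>, \<omega>). likelihood_ratio n \<theta> \<omega>) \<in> borel_measurable (\<pi> \<Otimes>\<^sub>M P0)"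
proof -
  have [measurable]: "p n \<theta>c \<in> borel_measurable (prod_n n X)"
    using density_measurable' n true_parameter .
  have "(\<lambda>z. p n (fst z) (restrict (snd z) {..<n})) \<in> borel_measurable (\<pi> \<Otimes>\<^sub>M P0)"
    using measurable_compose[of "\<lambda>z. (fst z, restrict (snd z) {..<n})" "\<pi> \<Otimes>\<^sub>M P0",
        OF _ density_measurable[OF n]] by simp
  then show ?thesis
    unfolding likelihood_ratio_def split_beta' by measurable
qed

text \<open>Only an inequality, because \<open>P \<theta>\<close> may charge the null set of the true density.\<close>

lemma nn_integral_likelihood_ratio_le:
  assumes n: "1 \<le> n" and \<theta>: "\<theta> \<in> space \<pi>" and F: "F \<in> borel_measurable (prod_n n X)"
  shows "(\<integral>\<^sup>+\<omega>. F (restrict \<omega> {..<n}) * likelihood_ratio n \<theta> \<omega> \<partial>P0) \<le>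
    (\<integral>\<^sup>+\<xi>. F \<xi> \<partial>prod_n n (P \<theta>))"
proof -
  note [measurable] = F density_measurable'[OF n \<theta>] density_measurable'[OF n true_parameter]
  note [measurable_cong] = sets_dominating[OF n] sets_prod_n[OF \<theta>, of n] sets_prod_n[OF true_parameter, of n]
  let ?G = "\<lambda>\<xi>. F \<xi> * (ennreal (p n \<theta> \<xi>) / ennreal (p n \<theta>c \<xi>))"
  have "(\<integral>\<^sup>+\<omega>. F (restrict \<omega> {..<n}) * likelihood_ratio n \<theta> \<omega> \<partial>P0) =
      (\<integral>\<^sup>+\<xi>. ?G \<xi> \<partial>prod_n n (P \<theta>c))"
    unfolding likelihood_ratio_def
    using nn_integral_prod_inf_restrict[OF prob_model[OF true_parameter], of ?G n] by simp
  also have "\<dots> = (\<integral>\<^sup>+\<xi>. ennreal (p n \<theta>c \<xi>) * ?G \<xi> \<partial>\<nu> n)"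
    unfolding density[OF n true_parameter] by (rule nn_integral_density) measurable
  also have "\<dots> \<le> (\<integral>\<^sup>+\<xi>. ennreal (p n \<theta> \<xi>) * F \<xi> \<partial>\<nu> n)"
  proof (rule nn_integral_mono)
    fix \<xi>
    \<comment> \<open>For \<open>b = 0\<close> the left side is 0, since \<open>0 * top = 0\<close>
      in \<open>ennreal\<close>; this is where mass can be lost.\<close>
    have "b * (f * (a / b)) \<le> a * f" if "b \<noteq> top" for a b f :: ennreal
    proof (cases "b = 0")
      case False
      have "b * (f * (a / b)) = (a * f) * b / b" by (simp add: ennreal_times_divide ac_simps)
      also have "\<dots> = a * f" using False that by (rule mult_divide_eq_ennreal)
      finally show ?thesis by simp
    qed simp
    then show "ennreal (p n \<theta>c \<xi>) * ?G \<xi> \<le> ennreal (p n \<theta> \<xi>) * F \<xi>" by simp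
  qed
  also have "\<dots> = (\<integral>\<^sup>+\<xi>. F \<xi> \<partial>prod_n n (P \<theta>))"
    unfolding density[OF n \<theta>] by (rule nn_integral_density[symmetric]) measurable
  finally show ?thesis .
qed

section \<open>Prior averages of the likelihood ratio and the exponential bound on the
  numerator\<close>

definition integrated_ratio :: "nat \<Rightarrow> 'a set \<Rightarrow> (nat \<Rightarrow> 'b) \<Rightarrow> ennreal" where
  "integrated_ratio n A \<omega> = (\<integral>\<^sup>+\<theta>\<in>A. likelihood_ratio n \<theta> \<omega> \<partial>\<pi>)"

lemma integrated_ratio_measurable:
  assumes n: "1 \<le> n" and [measurable]: "A \<in> sets \<pi>"
  shows "integrated_ratio n A \<in> borel_measurable P0"
proof -
  note [measurable] = likelihood_ratio_measurable[OF n]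
  show ?thesis unfolding integrated_ratio_def by measurable
qed

text \<open>After exchanging the integrals, the likelihood ratio changes the true law into
  \<open>P \<theta>\<close> for each parameter separately, where \<open>le\<close> applies; the
  prior has mass one, so averaging preserves the bound.\<close>

lemma nn_integral_integrated_ratio_le:
  assumes n: "1 \<le> n" and A: "A \<in> sets \<pi>" and F: "F \<in> borel_measurable (prod_n n X)"
    and le: "\<And>\<theta>. \<theta> \<in> A \<Longrightarrow> (\<integral>\<^sup>+\<xi>. F \<xi> \<partial>prod_n n (P \<theta>)) \<le> c"
  shows "(\<integral>\<^sup>+\<omega>. F (restrict \<omega> {..<n}) * integrated_ratio n A \<omega> \<partial>P0) \<le> c"
proof -
  note [measurable] = likelihood_ratio_measurable[OF n] F A
  have "(\<integral>\<^sup>+\<omega>. F (restrict \<omega> {..<n}) * integrated_ratio n A \<omega> \<partial>P0)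
      = (\<integral>\<^sup>+\<omega>. \<integral>\<^sup>+\<theta>. F (restrict \<omega> {..<n}) * (likelihood_ratio n \<theta> \<omega> * indicator A \<theta>) \<partial>\<pi> \<partial>P0)"
    unfolding integrated_ratio_def
    by (intro nn_integral_cong nn_integral_cmult[symmetric]) measurable
  also have "\<dots> = (\<integral>\<^sup>+\<theta>. \<integral>\<^sup>+\<omega>. F (restrict \<omega> {..<n}) * (likelihood_ratio n \<theta> \<omega> * indicator A \<theta>) \<partial>P0 \<partial>\<pi>)"
    by (rule prior_P0.Fubini') measurable
  also have "\<dots> \<le> (\<integral>\<^sup>+\<theta>. c \<partial>\<pi>)"
  proof (rule nn_integral_mono)
    fix \<theta> assume \<theta>: "\<theta> \<in> space \<pi>"
    show "(\<integral>\<^sup>+\<omega>. F (restrict \<omega> {..<n}) * (likelihood_ratio n \<theta> \<omega> * indicator A \<theta>) \<partial>P0) \<le> c"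
      using order_trans[OF nn_integral_likelihood_ratio_le[OF n \<theta> F] le[of \<theta>]]
      by (cases "\<theta> \<in> A") auto
  qed
  also have "\<dots> = c" by (simp add: prior.emeasure_space_1)
  finally show ?thesis .
qed

text \<open>The case of weight 1: the mean under the true law is at most 1. Finiteness rules out the
  quotient \<open>top / top\<close> as the total mass of the posterior.\<close>

lemma AE_integrated_ratio_finite:
  assumes "1 \<le> n"
  shows "AE \<omega> in P0. integrated_ratio n (space \<pi>) \<omega> \<noteq> \<infinity>"
proof (rule nn_integral_PInf_AE)
  have "(\<integral>\<^sup>+\<xi>. 1 \<partial>prod_n n (P \<theta>)) \<le> 1" if "\<theta> \<in> space \<pi>" for \<theta>
    using prob_space.emeasure_space_1[OF prob_space_PiM[OF prob_model[OF that]], of "{..<n}"] by simp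
  from nn_integral_integrated_ratio_le[OF assms sets.top, of "\<lambda>_. 1" 1] this
  show "(\<integral>\<^sup>+\<omega>. integrated_ratio n (space \<pi>) \<omega> \<partial>P0) \<noteq> \<infinity>"
    by (auto simp: top_unique)
qed (rule integrated_ratio_measurable[OF assms sets.top])

text \<open>With weight \<open>v = 1 + \<phi>\<close> per block, the product of the weights grows slower than \<open>(10 / 9)\<^sup>N\<close>
  under the true parameter, and the mean of the product of the \<open>1 / v\<close> is at most \<open>(11 / 20)\<^sup>N\<close>
  under the alternatives. This turns a single good test into an exponential rate.\<close>

lemma AE_integrated_ratio_exponentially_small:
  fixes \<phi> :: "(nat \<Rightarrow> 'b) \<Rightarrow> real"
  assumes k: "1 \<le> k" and A: "A \<in> sets \<pi>" and \<phi>[measurable]: "\<phi> \<in> borel_measurable (prod_n k X)"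
    and \<phi>_range: "\<And>\<xi>. \<xi> \<in> space (prod_n k X) \<Longrightarrow> 0 \<le> \<phi> \<xi> \<and> \<phi> \<xi> \<le> 1"
    and null: "(\<integral>\<xi>. \<phi> \<xi> \<partial>prod_n k (P \<theta>c)) \<le> 1 / 10"
    and alt: "\<And>\<theta>. \<theta> \<in> A \<Longrightarrow> (\<integral>\<xi>. 1 - \<phi> \<xi> \<partial>prod_n k (P \<theta>)) \<le> 1 / 10"
  shows "AE \<omega> in P0. (\<lambda>n. ennreal ((3 / 2) ^ (Suc n div k)) * integrated_ratio (Suc n) A \<omega>) \<longlonglongrightarrow> 0"
proof -
  define v where "v \<xi> = ennreal (1 + \<phi> \<xi>)" for \<xi>
  define u where "u \<xi> = ennreal (1 / (1 + \<phi> \<xi>))" for \<xi>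
  have [measurable]: "v \<in> borel_measurable (prod_n k X)" "u \<in> borel_measurable (prod_n k X)"
    unfolding v_def u_def by measurable
  define bl where "bl \<omega> j = (\<lambda>i\<in>{..<k}. \<omega> (j * k + i))" for j and \<omega> :: "nat \<Rightarrow> 'b"
  have [measurable]: "(\<lambda>\<omega>. bl \<omega> j) \<in> prod_inf X \<rightarrow>\<^sub>M prod_n k X" for j
    unfolding bl_def by (rule measurable_block)
  \<comment> \<open>Only complete blocks are used, so the weights are functions of the first
    \<open>n\<close> observations.\<close>
  have bl_restrict: "bl (restrict \<omega> {..<n}) j = bl \<omega> j" if "j < n div k" for j n \<omega>
  proof -
    have "Suc j * k \<le> n div k * k" using that by (intro mult_right_mono) auto
    also have "\<dots> \<le> n" by simp
    finally show ?thesis by (auto simp: bl_def)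
  qed
  have uv: "u \<xi> * v \<xi> = 1" if "\<xi> \<in> space (prod_n k X)" for \<xi>
    using \<phi>_range[OF that] by (simp add: u_def v_def ennreal_mult[symmetric] del: ennreal_plus)
  have int: "integrable (prod_n k (P \<theta>)) \<phi>" if "\<theta> \<in> space \<pi>" for \<theta>
  proof -
    interpret prob_space "prod_n k (P \<theta>)" by (intro prob_space_PiM prob_model that)
    show ?thesis
      by (rule integrable_const_bound[of _ 1])
         (use \<phi>_range sets_eq_imp_space_eq[OF sets_prod_n[OF that, of k]] \<phi> in
          \<open>auto cong: measurable_cong_sets[OF sets_prod_n[OF that]]\<close>)
  qed
  have Ev: "(\<integral>\<^sup>+\<xi>. v \<xi> \<partial>prod_n k (P \<theta>c)) \<le> ennreal (11 / 10)"
  proof -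
    interpret prob_space "prod_n k (P \<theta>c)" by (intro prob_space_PiM prob_model true_parameter)
    have "(\<integral>\<^sup>+\<xi>. v \<xi> \<partial>prod_n k (P \<theta>c)) = ennreal (\<integral>\<xi>. 1 + \<phi> \<xi> \<partial>prod_n k (P \<theta>c))"
      unfolding v_def using \<phi>_range sets_eq_imp_space_eq[OF sets_prod_n[OF true_parameter, of k]]
      by (intro nn_integral_eq_integral Bochner_Integration.integrable_add int true_parameter AE_I2)
         (auto intro: add_nonneg_nonneg)
    also have "\<dots> \<le> ennreal (11 / 10)"
      using null int[OF true_parameter] by (intro ennreal_leI) (simp add: prob_space)
    finally show ?thesis .
  qed
  \<comment> \<open>Chord bound for the convex function \<open>1 / (1 + t)\<close> on the unit
    interval, equivalent to \<open>0 \<le> t * (1 - t)\<close>. The constant is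
    \<open>1 / 2 + (1 / 10) / 2\<close>.\<close>
  have Eu: "(\<integral>\<^sup>+\<xi>. u \<xi> \<partial>prod_n k (P \<theta>)) \<le> ennreal (11 / 20)" if "\<theta> \<in> A" for \<theta>
  proof -
    have \<theta>: "\<theta> \<in> space \<pi>" using that A sets.sets_into_space by auto
    interpret prob_space "prod_n k (P \<theta>)" by (intro prob_space_PiM prob_model \<theta>)
    note sp = sets_eq_imp_space_eq[OF sets_prod_n[OF \<theta>, of k]]
    have "(\<integral>\<^sup>+\<xi>. u \<xi> \<partial>prod_n k (P \<theta>)) \<le> (\<integral>\<^sup>+\<xi>. ennreal (1 / 2 + (1 - \<phi> \<xi>) / 2) \<partial>prod_n k (P \<theta>))"
    proof (rule nn_integral_mono)
      fix \<xi> assume "\<xi> \<in> space (prod_n k (P \<theta>))"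
      then have r: "0 \<le> \<phi> \<xi>" "\<phi> \<xi> \<le> 1" using \<phi>_range[of \<xi>] sp by auto
      then have "0 \<le> \<phi> \<xi> * (1 - \<phi> \<xi>)" by simp
      then have "1 / (1 + \<phi> \<xi>) \<le> 1 / 2 + (1 - \<phi> \<xi>) / 2"
        using r by (simp add: field_simps)
      then show "u \<xi> \<le> ennreal (1 / 2 + (1 - \<phi> \<xi>) / 2)"
        unfolding u_def by (rule ennreal_leI)
    qed
    also have "\<dots> = ennreal (\<integral>\<xi>. 1 / 2 + (1 - \<phi> \<xi>) / 2 \<partial>prod_n k (P \<theta>))"
      using \<phi>_range sp int[OF \<theta>] by (intro nn_integral_eq_integral AE_I2) auto
    also have "(\<integral>\<xi>. 1 / 2 + (1 - \<phi> \<xi>) / 2 \<partial>prod_n k (P \<theta>))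
        = 1 / 2 + (\<integral>\<xi>. 1 - \<phi> \<xi> \<partial>prod_n k (P \<theta>)) / 2"
      using int[OF \<theta>] by (subst Bochner_Integration.integral_add) (auto simp: prob_space)
    also have "ennreal \<dots> \<le> ennreal (11 / 20)"
      using alt[OF that] by (intro ennreal_leI) simp
    finally show ?thesis .
  qed
  define V where "V N \<omega> = (\<Prod>j<N. v (bl \<omega> j))" for N \<omega>
  define U where "U N \<omega> = (\<Prod>j<N. u (bl \<omega> j))" for N \<omega>
  have [measurable]: "V N \<in> borel_measurable (prod_inf X)" "U N \<in> borel_measurable (prod_inf X)" for N
    unfolding V_def U_def by measurable
  have UV: "U N \<omega> * V N \<omega> = 1" if "\<omega> \<in> space P0" for N \<omega>
  proof -
    have "bl \<omega> j \<in> space (prod_n k X)" for j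
      using that sets_eq_imp_space_eq[OF sets_P0] by (auto simp: bl_def space_PiM PiE_iff)
    then show ?thesis by (simp add: U_def V_def prod.distrib[symmetric] uv)
  qed
  have EV: "(\<integral>\<^sup>+\<omega>. V N \<omega> \<partial>P0) \<le> ennreal ((11 / 10) ^ N)" for N
  proof -
    have "(\<integral>\<^sup>+\<omega>. V N \<omega> \<partial>P0) = (\<integral>\<^sup>+\<xi>. v \<xi> \<partial>prod_n k (P \<theta>c)) ^ N"
      unfolding V_def bl_def
      by (rule nn_integral_prod_blocks[OF prob_model[OF true_parameter]])
         (simp cong: measurable_cong_sets[OF sets_prod_n[OF true_parameter]])
    also have "\<dots> \<le> ennreal (11 / 10) ^ N" by (intro power_mono Ev) simp
    finally show ?thesis by (simp add: ennreal_power)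
  qed
  have EU: "(\<integral>\<^sup>+\<omega>. U (n div k) \<omega> * integrated_ratio n A \<omega> \<partial>P0) \<le> ennreal ((11 / 20) ^ (n div k))"
    if n: "1 \<le> n" for n
  proof -
    have U_restrict: "U (n div k) (restrict \<omega> {..<n}) = U (n div k) \<omega>" for \<omega>
      unfolding U_def by (intro prod.cong) (auto simp: bl_restrict)
    have bl_n: "(\<lambda>\<xi>. bl \<xi> j) \<in> prod_n n X \<rightarrow>\<^sub>M prod_n k X" if "j < n div k" for j
    proof -
      have "Suc j * k \<le> n div k * k" using that by (intro mult_right_mono) auto
      also have "\<dots> \<le> n" by simp
      finally show ?thesis unfolding bl_def
        by (intro measurable_restrict measurable_component_singleton) auto
    qed
    have U_n: "U (n div k) \<in> borel_measurable (prod_n n X)"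
      unfolding U_def by (intro borel_measurable_prod_ennreal measurable_compose[OF bl_n]) auto
    have "(\<integral>\<^sup>+\<omega>. U (n div k) (restrict \<omega> {..<n}) * integrated_ratio n A \<omega> \<partial>P0) \<le> ennreal ((11 / 20) ^ (n div k))"
    proof (rule nn_integral_integrated_ratio_le[OF n A U_n])
      fix \<theta> assume "\<theta> \<in> A"
      then have \<theta>: "\<theta> \<in> space \<pi>" using A sets.sets_into_space by auto
      have "(\<integral>\<^sup>+\<xi>. U (n div k) \<xi> \<partial>prod_n n (P \<theta>)) = (\<integral>\<^sup>+\<omega>. U (n div k) (restrict \<omega> {..<n}) \<partial>prod_inf (P \<theta>))"
        by (rule nn_integral_prod_inf_restrict[OF prob_model[OF \<theta>], symmetric])
           (simp add: U_n cong: measurable_cong_sets[OF sets_prod_n[OF \<theta>]])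
      also have "\<dots> = (\<integral>\<^sup>+\<xi>. u \<xi> \<partial>prod_n k (P \<theta>)) ^ (n div k)"
        unfolding U_restrict unfolding U_def bl_def
        by (rule nn_integral_prod_blocks[OF prob_model[OF \<theta>]])
           (simp cong: measurable_cong_sets[OF sets_prod_n[OF \<theta>]])
      also have "\<dots> \<le> ennreal (11 / 20) ^ (n div k)" by (intro power_mono Eu \<open>\<theta> \<in> A\<close>) simp
      finally show "(\<integral>\<^sup>+\<xi>. U (n div k) \<xi> \<partial>prod_n n (P \<theta>)) \<le> ennreal ((11 / 20) ^ (n div k))"
        by (simp add: ennreal_power)
    qed
    then show ?thesis unfolding U_restrict .
  qed
  have meas_R[measurable]: "integrated_ratio (Suc n) A \<in> borel_measurable P0" for n
    by (rule integrated_ratio_measurable) (use A in auto)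
  have geometric: "AE \<omega> in P0. (\<lambda>n. ennreal (a ^ (Suc n div k)) * f n \<omega>) \<longlonglongrightarrow> 0"
    if [measurable]: "\<And>n. f n \<in> borel_measurable P0"
      and le: "\<And>n. (\<integral>\<^sup>+\<omega>. f n \<omega> \<partial>P0) \<le> ennreal (b ^ (Suc n div k))"
      and ab: "0 < a" "0 < b" "a * b < 1" for f :: "nat \<Rightarrow> (nat \<Rightarrow> 'b) \<Rightarrow> ennreal" and a b :: real
  proof -
    obtain C s where C: "0 \<le> C" "0 \<le> s" "s < 1" "\<And>n. (a * b) ^ (n div k) \<le> C * s ^ n"
      using power_div_le_geometric[of "a * b" k] ab k by auto
    \<comment> \<open>The extra factor \<open>s\<close> in the constant accounts for the index
      \<open>Suc n\<close>.\<close>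
    show ?thesis
    proof (rule AE_tendsto_0_if_geometric_nn_integral[where r = s and C = "C * s"])
      fix n
      have "(\<integral>\<^sup>+\<omega>. ennreal (a ^ (Suc n div k)) * f n \<omega> \<partial>P0)
          = ennreal (a ^ (Suc n div k)) * (\<integral>\<^sup>+\<omega>. f n \<omega> \<partial>P0)"
        by (rule nn_integral_cmult) measurable
      also have "\<dots> \<le> ennreal (a ^ (Suc n div k)) * ennreal (b ^ (Suc n div k))"
        by (intro mult_left_mono le) simp
      also have "\<dots> = ennreal ((a * b) ^ (Suc n div k))"
        using ab by (simp add: ennreal_mult[symmetric] power_mult_distrib)
      also have "\<dots> \<le> ennreal (C * s * s ^ n)"
        using C(4)[of "Suc n"] by (intro ennreal_leI) (simp add: mult.assoc)
      finally show "(\<integral>\<^sup>+\<omega>. ennreal (a ^ (Suc n div k)) * f n \<omega> \<partial>P0) \<le> ennreal (C * s * s ^ n)" .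
    qed (use C in auto)
  qed
  \<comment> \<open>The rates fit because \<open>9/10 * 11/10 = 99/100\<close> and
    \<open>5/3 * 11/20 = 11/12\<close> are below 1. Multiplying the two limits cancels
    \<open>U\<close> against \<open>V\<close> and leaves \<open>9/10 * 5/3 = 3/2\<close> per
    block.\<close>
  have "AE \<omega> in P0. (\<lambda>n. ennreal ((9 / 10) ^ (Suc n div k)) * V (Suc n div k) \<omega>) \<longlonglongrightarrow> 0"
    by (rule geometric, measurable, rule EV) auto
  moreover have "AE \<omega> in P0. (\<lambda>n. ennreal ((5 / 3) ^ (Suc n div k)) *
      (U (Suc n div k) \<omega> * integrated_ratio (Suc n) A \<omega>)) \<longlonglongrightarrow> 0"
    by (rule geometric, measurable, rule EU) auto
  ultimately show ?thesis using AE_space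
  proof eventually_elim
    case (elim \<omega>)
    have "ennreal ((9 / 10) ^ N) * V N \<omega> * (ennreal ((5 / 3) ^ N) * (U N \<omega> * R))
        = ennreal ((3 / 2) ^ N) * R" for N R
    proof -
      have "ennreal ((9 / 10) ^ N) * V N \<omega> * (ennreal ((5 / 3) ^ N) * (U N \<omega> * R))
          = (ennreal ((9 / 10) ^ N) * ennreal ((5 / 3) ^ N)) * (U N \<omega> * V N \<omega>) * R"
        by (simp only: ac_simps)
      also have "\<dots> = ennreal ((3 / 2) ^ N) * R"
        by (simp add: UV[OF elim(3)] ennreal_mult[symmetric] power_mult_distrib[symmetric])
      finally show ?thesis .
    qed
    with tendsto_mult_ennreal[OF elim(1,2)] show ?case by simp
  qed
qed

section \<open>Growth of the denominator under the true parameter\<close>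

lemma AE_true_density_pos:
  assumes n: "1 \<le> n"
  shows "AE \<omega> in P0. 0 < p n \<theta>c (restrict \<omega> {..<n})"
proof (rule AE_prod_inf_restrict[OF prob_model[OF true_parameter]])
  have "(\<lambda>\<xi>. ennreal (p n \<theta>c \<xi>)) \<in> borel_measurable (\<nu> n)"
    using density_measurable'[OF n true_parameter]
    by (simp cong: measurable_cong_sets[OF sets_dominating[OF n]])
  then show "AE \<xi> in prod_n n (P \<theta>c). 0 < p n \<theta>c \<xi>"
    unfolding density[OF n true_parameter] by (subst AE_density) auto
qed

text \<open>A divergence below \<open>ereal c\<close> is not the default value
  \<open>\<infinity>\<close>, so absolute continuity and integrability hold. They concern functions
  on \<open>{..<1}\<close>, where \<open>p 1\<close> lives; \<open>?r\<close> carries the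
  Radon-Nikodym derivative \<open>g1\<close> over to the sample space, where single coordinates are
  independent.\<close>

lemma D_KL_less_imp_density:
  assumes \<theta>: "\<theta> \<in> space \<pi>" and KL: "D_KL (\<nu> 1) (p 1 \<theta>c) (p 1 \<theta>) < ereal c"
  obtains g where "g \<in> borel_measurable (P \<theta>)" "density (P \<theta>) g = P \<theta>c"
    "integrable (P \<theta>c) (\<lambda>x. ln (enn2real (g x)))" "(\<integral>x. ln (enn2real (g x)) \<partial>P \<theta>c) < c"
proof -
  let ?Q = "prod_n 1 (P \<theta>)" and ?P = "prod_n 1 (P \<theta>c)" and ?r = "\<lambda>x. \<lambda>i\<in>{..<1::nat}. x"
  have KL': "absolutely_continuous ?Q ?P" "integrable ?P (entropy_density (exp 1) ?Q ?P)"
    "KL_divergence (exp 1) ?Q ?P < c"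
    using KL unfolding D_KL_def density[OF order_refl \<theta>] density[OF order_refl true_parameter] Let_def
    by (auto split: if_splits)
  interpret Q: prob_space "P \<theta>" by (rule prob_model[OF \<theta>])
  interpret Q1: prob_space ?Q by (intro prob_space_PiM prob_model \<theta>)
  interpret P: prob_space "P \<theta>c" by (rule prob_model[OF true_parameter])
  interpret Qf: product_sigma_finite "\<lambda>_::nat. P \<theta>"
    using Q.sigma_finite_measure_axioms by (simp add: product_sigma_finite_def)
  interpret Pf: product_sigma_finite "\<lambda>_::nat. P \<theta>c"
    using P.sigma_finite_measure_axioms by (simp add: product_sigma_finite_def)
  define g1 where "g1 = RN_deriv ?Q ?P"
  define g where "g x = g1 (?r x)" for x
  have sets_eq: "sets (P \<theta>) = sets (P \<theta>c)" by (simp add: sets_model \<theta> true_parameter)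
  have [measurable]: "g1 \<in> borel_measurable ?Q" unfolding g1_def by simp
  have sets_PQ: "sets ?P = sets ?Q" by (simp add: sets_prod_n \<theta> true_parameter)
  have g1_P: "g1 \<in> borel_measurable ?P"
    by (subst measurable_cong_sets[OF sets_PQ refl]) measurable
  have rQ[measurable]: "?r \<in> P \<theta> \<rightarrow>\<^sub>M ?Q" by measurable
  have rP: "?r \<in> P \<theta>c \<rightarrow>\<^sub>M ?P" by measurable
  have single: "{..<1::nat} = {0}" by auto
  have dQ: "distr (P \<theta>) ?Q ?r = ?Q" unfolding single by (rule Qf.distr_component)
  have dP: "distr (P \<theta>c) ?P ?r = ?P" unfolding single by (rule Pf.distr_component)
  have dP0: "distr ?P (P \<theta>c) (\<lambda>x. x 0) = P \<theta>c" unfolding single by (rule Pf.distr_singleton)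
  have density1: "density ?Q g1 = ?P"
    unfolding g1_def by (rule Q1.density_RN_deriv[OF KL'(1)])
      (simp add: sets_prod_n \<theta> true_parameter)
  have g_meas[measurable]: "g \<in> borel_measurable (P \<theta>)" unfolding g_def by measurable
  have "density (P \<theta>) g = P \<theta>c"
  proof (rule measure_eqI)
    fix A assume "A \<in> sets (density (P \<theta>) g)"
    then have A[measurable]: "A \<in> sets (P \<theta>)" by simp
    have A': "A \<in> sets (P \<theta>c)" using A sets_eq by simp
    have "(\<lambda>x. x 0) \<in> ?Q \<rightarrow>\<^sub>M P \<theta>" by (rule measurable_component_singleton) simp
    then have [measurable]: "(\<lambda>x. x 0) -` A \<inter> space ?Q \<in> sets ?Q" by (rule measurable_sets[OF _ A])
    have "emeasure (P \<theta>c) A = emeasure (density ?Q g1) ((\<lambda>x. x 0) -` A \<inter> space ?P)"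
      unfolding density1 by (subst (1) dP0[symmetric], rule emeasure_distr) (use A' in auto)
    also have "space ?P = space ?Q"
      using sets_eq_imp_space_eq[OF sets_eq] by (simp add: space_PiM)
    also have "emeasure (density ?Q g1) ((\<lambda>x. x 0) -` A \<inter> space ?Q)
        = (\<integral>\<^sup>+x. g1 x * indicator ((\<lambda>x. x 0) -` A \<inter> space ?Q) x \<partial>?Q)"
      by (rule emeasure_density) measurable
    also have "\<dots> = (\<integral>\<^sup>+x. g1 (?r x) * indicator ((\<lambda>x. x 0) -` A \<inter> space ?Q) (?r x) \<partial>P \<theta>)"
      by (subst (1) dQ[symmetric], rule nn_integral_distr) measurable
    also have "\<dots> = (\<integral>\<^sup>+x. g x * indicator A x \<partial>P \<theta>)"
      by (rule nn_integral_cong) (auto simp: g_def indicator_def space_PiM)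
    also have "\<dots> = emeasure (density (P \<theta>) g) A"
      by (rule emeasure_density[symmetric]) measurable
    finally show "emeasure (density (P \<theta>) g) A = emeasure (P \<theta>c) A" ..
  qed (simp add: sets_eq)
  moreover have ent: "entropy_density (exp 1) ?Q ?P = (\<lambda>x. ln (enn2real (g1 x)))"
    by (simp add: entropy_density_def g1_def log_def fun_eq_iff)
  have "integrable (P \<theta>c) (\<lambda>x. ln (enn2real (g x)))"
    using KL'(2) unfolding ent g_def
    by (subst (asm) dP[symmetric], subst (asm) integrable_distr_eq[OF rP])
       (auto cong: measurable_cong_sets simp: sets_prod_n \<theta> true_parameter)
  moreover have "(\<integral>x. ln (enn2real (g x)) \<partial>P \<theta>c) = (\<integral>x. ln (enn2real (g1 x)) \<partial>?P)"
    unfolding g_def by (subst dP[symmetric], rule integral_distr[OF rP, symmetric])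
       (use g1_P in measurable)
  then have "(\<integral>x. ln (enn2real (g x)) \<partial>P \<theta>c) < c"
    using KL'(3) by (simp only: KL_divergence_def ent)
  ultimately show thesis using that g_meas by blast
qed

text \<open>The likelihood ratio is the reciprocal of the product of the
  \<open>g (\<omega> i)\<close>, so its logarithm is minus a sum of independent terms
  \<open>l (\<omega> i)\<close> whose mean is the divergence.\<close>

lemma AE_likelihood_ratio_growth:
  assumes \<theta>: "\<theta> \<in> space \<pi>" and KL: "D_KL (\<nu> 1) (p 1 \<theta>c) (p 1 \<theta>) < ereal c"
  shows "AE \<omega> in P0. (\<lambda>n. ennreal (exp (c * Suc n)) * likelihood_ratio (Suc n) \<theta> \<omega>) \<longlonglongrightarrow> top"
proof -
  obtain g where g[measurable]: "g \<in> borel_measurable (P \<theta>)" and dens: "density (P \<theta>) g = P \<theta>c"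
    and int: "integrable (P \<theta>c) (\<lambda>x. ln (enn2real (g x)))"
    and lt: "(\<integral>x. ln (enn2real (g x)) \<partial>P \<theta>c) < c"
    using D_KL_less_imp_density[OF \<theta> KL] .
  interpret Q: prob_space "P \<theta>" by (rule prob_model[OF \<theta>])
  interpret P: prob_space "P \<theta>c" by (rule prob_model[OF true_parameter])
  define l where "l x = ln (enn2real (g x))" for x
  \<comment> \<open>Subtracting \<open>d\<close> makes the mean negative, so the sums stay bounded
    above; the gap \<open>c - d\<close> is what remains to drive the exponent to infinity.\<close>
  obtain d where d: "(\<integral>x. l x \<partial>P \<theta>c) < d" "d < c" using dense[OF lt] unfolding l_def by blast
  have "AE \<omega> in P0. \<exists>C. \<forall>n. (\<Sum>i<n. l (\<omega> i) - d) \<le> C"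
    by (rule AE_partial_sums_bounded) (use int d in \<open>simp_all add: l_def prob_model true_parameter P.prob_space\<close>)
  \<comment> \<open>Finite because \<open>g\<close> integrates to 1 under \<open>P \<theta>\<close>,
    positive because a measure does not charge the zeros of its own density.\<close>
  moreover have "AE x in P \<theta>c. 0 < g x \<and> g x < top"
  proof -
    have "(\<integral>\<^sup>+x. g x \<partial>P \<theta>) = emeasure (density (P \<theta>) g) (space (P \<theta>))"
      by (subst emeasure_density) (auto intro!: nn_integral_cong)
    also have "\<dots> = 1"
      using P.emeasure_space_1 unfolding dens
      by (simp add: sets_eq_imp_space_eq[of "P \<theta>" "P \<theta>c"] sets_model \<theta> true_parameter)
    finally have "AE x in P \<theta>. g x \<noteq> \<infinity>" by (intro nn_integral_PInf_AE) auto
    then show ?thesis unfolding dens[symmetric] by (subst AE_density) (auto simp: less_top)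
  qed
  then have "AE \<omega> in P0. \<forall>i. 0 < g (\<omega> i) \<and> g (\<omega> i) < top"
    unfolding AE_all_countable by (intro allI AE_PiM_component) (auto simp: prob_model true_parameter)
  \<comment> \<open>Both sides are densities of the n-fold product of \<open>P \<theta>c\<close>
    with respect to the same sigma-finite \<open>\<nu> n\<close>, hence equal almost everywhere.
    This supplies the product structure of the likelihood ratio.\<close>
  moreover have "AE \<omega> in P0. \<forall>n. ennreal (p (Suc n) \<theta> (restrict \<omega> {..<Suc n})) * (\<Prod>i<Suc n. g (\<omega> i))
      = ennreal (p (Suc n) \<theta>c (restrict \<omega> {..<Suc n}))"
    unfolding AE_all_countable
  proof
    fix m
    define n where "n = Suc m"
    have n: "1 \<le> n" by (simp add: n_def)
    note [measurable_cong] = sets_dominating[OF n] sets_prod_n[OF \<theta>, of n] sets_prod_n[OF true_parameter, of n]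
    note [measurable] = density_measurable'[OF n \<theta>] density_measurable'[OF n true_parameter]
    interpret \<nu>: sigma_finite_measure "\<nu> n" by (rule sigma_finite_dominating[OF n])
    have [measurable]: "g \<in> borel_measurable X"
      using g by (simp cong: measurable_cong_sets[OF sets_model[OF \<theta>]])
    have "density (\<nu> n) (\<lambda>\<xi>. ennreal (p n \<theta> \<xi>) * (\<Prod>i<n. g (\<xi> i)))
        = density (prod_n n (P \<theta>)) (\<lambda>\<xi>. \<Prod>i<n. g (\<xi> i))"
      unfolding density[OF n \<theta>] by (rule density_density_eq[symmetric]) measurable
    also have "\<dots> = prod_n n (P \<theta>c)"
      unfolding dens[symmetric]
      by (rule PiM_density[symmetric]) (simp_all add: dens Q.prob_space_axioms P.prob_space_axioms)
    also have "\<dots> = density (\<nu> n) (\<lambda>\<xi>. ennreal (p n \<theta>c \<xi>))"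
      by (rule density[OF n true_parameter])
    finally have "AE \<xi> in \<nu> n. ennreal (p n \<theta> \<xi>) * (\<Prod>i<n. g (\<xi> i)) = ennreal (p n \<theta>c \<xi>)"
      by (intro \<nu>.density_unique) measurable
    then have AE_n: "AE \<xi> in prod_n n (P \<theta>c). ennreal (p n \<theta> \<xi>) * (\<Prod>i<n. g (\<xi> i)) = ennreal (p n \<theta>c \<xi>)"
      unfolding density[OF n true_parameter] by (subst AE_density) auto
    have "(\<Prod>i<n. g (restrict \<omega> {..<n} i)) = (\<Prod>i<n. g (\<omega> i))" for \<omega>
      by (rule prod.cong) auto
    with AE_prod_inf_restrict[OF prob_model[OF true_parameter] AE_n]
    show "AE \<omega> in P0. ennreal (p (Suc m) \<theta> (restrict \<omega> {..<Suc m})) * (\<Prod>i<Suc m. g (\<omega> i))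
      = ennreal (p (Suc m) \<theta>c (restrict \<omega> {..<Suc m}))"
      unfolding n_def[symmetric] by (simp only:)
  qed
  moreover have "AE \<omega> in P0. \<forall>n. 0 < p (Suc n) \<theta>c (restrict \<omega> {..<Suc n})"
    unfolding AE_all_countable by (intro allI AE_true_density_pos) simp
  ultimately show ?thesis
  proof eventually_elim
    case (elim \<omega>)
    obtain C where C: "\<And>n. (\<Sum>i<n. l (\<omega> i) - d) \<le> C" using elim(1) by blast
    have ratio: "likelihood_ratio (Suc n) \<theta> \<omega> = ennreal (exp (- (\<Sum>i<Suc n. l (\<omega> i))))" for n
    proof -
      define E where "E = exp (\<Sum>i<Suc n. l (\<omega> i))"
      define a b where "a = p (Suc n) \<theta> (restrict \<omega> {..<Suc n})" and "b = p (Suc n) \<theta>c (restrict \<omega> {..<Suc n})"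
      have "g (\<omega> i) = ennreal (exp (l (\<omega> i)))" for i
        using elim(2)[rule_format, of i]
        by (cases "g (\<omega> i)" rule: ennreal_cases) (auto simp: l_def ennreal_less_zero_iff)
      then have "(\<Prod>i<Suc n. g (\<omega> i)) = ennreal E"
        by (simp add: E_def exp_sum prod_ennreal del: prod.lessThan_Suc sum.lessThan_Suc)
      then have eq: "ennreal a * ennreal E = ennreal b"
        using elim(3)[rule_format, of n] by (simp only: a_def b_def)
      have b: "0 < b" using elim(4) by (simp add: b_def)
      have E: "0 < E" by (simp add: E_def)
      \<comment> \<open>A zero of the density at \<open>\<theta>\<close> would force the true
        density \<open>b\<close> to vanish.\<close>
      have a: "0 < a"
      proof (rule ccontr)
        assume "\<not> 0 < a"
        then have "ennreal a = 0" by (simp add: ennreal_eq_0_iff)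
        with eq b show False by (simp add: ennreal_eq_0_iff)
      qed
      have "a * E = b"
        using eq a E b by (simp add: ennreal_mult[symmetric])
      then have "a / b = 1 / E" using a E by auto
      then have "a / b = exp (- (\<Sum>i<Suc n. l (\<omega> i)))"
        by (simp only: E_def exp_minus inverse_eq_divide)
      moreover have "likelihood_ratio (Suc n) \<theta> \<omega> = ennreal (a / b)"
        unfolding likelihood_ratio_def a_def[symmetric] b_def[symmetric]
        using a b by (simp add: divide_ennreal)
      ultimately show ?thesis by simp
    qed
    have "LIM n sequentially. exp (c * Suc n - (\<Sum>i<Suc n. l (\<omega> i))) :> at_top"
    proof (rule filterlim_compose[OF exp_at_top])
      have "LIM n sequentially. (c - d) * real (Suc n) :> at_top"
        using d(2) by (intro filterlim_tendsto_pos_mult_at_top[OF tendsto_const]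
          filterlim_compose[OF filterlim_real_sequentially filterlim_Suc]) simp
      then have "LIM n sequentially. - C + (c - d) * real (Suc n) :> at_top"
        by (rule filterlim_tendsto_add_at_top[OF tendsto_const])
      then have "LIM n sequentially. (c - d) * real (Suc n) - C :> at_top" by simp
      then show "LIM n sequentially. c * Suc n - (\<Sum>i<Suc n. l (\<omega> i)) :> at_top"
      proof (rule filterlim_at_top_mono)
        show "\<forall>\<^sub>F n in sequentially. (c - d) * real (Suc n) - C \<le> c * Suc n - (\<Sum>i<Suc n. l (\<omega> i))"
        proof (intro always_eventually allI)
          fix n
          have "(\<Sum>i<Suc n. l (\<omega> i)) - real (Suc n) * d \<le> C"
            using C[of "Suc n"] by (simp add: sum_subtractf del: sum.lessThan_Suc)
          then show "(c - d) * real (Suc n) - C \<le> c * Suc n - (\<Sum>i<Suc n. l (\<omega> i))"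
            by (simp add: algebra_simps del: sum.lessThan_Suc)
        qed
      qed
    qed
    then have "(\<lambda>n. ennreal (exp (c * Suc n - (\<Sum>i<Suc n. l (\<omega> i))))) \<longlonglongrightarrow> top"
      by (simp only: ennreal_tendsto_top_eq_at_top)
    moreover have "ennreal (exp (c * Suc n)) * likelihood_ratio (Suc n) \<theta> \<omega> =
        ennreal (exp (c * Suc n - (\<Sum>i<Suc n. l (\<omega> i))))" for n
      unfolding ratio by (subst ennreal_mult[symmetric]) (simp_all only: exp_ge_zero exp_add[symmetric] diff_conv_add_uminus)
    ultimately show ?case by (simp only:)
  qed
qed

lemma AE_integrated_ratio_growth:
  assumes W[measurable]: "W \<in> sets \<pi>" and pos: "0 < measure \<pi> W"
    and KL: "\<And>\<theta>. \<theta> \<in> W \<Longrightarrow> D_KL (\<nu> 1) (p 1 \<theta>c) (p 1 \<theta>) < ereal c"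
  shows "AE \<omega> in P0. (\<lambda>n. ennreal (exp (c * Suc n)) * integrated_ratio (Suc n) (space \<pi>) \<omega>) \<longlonglongrightarrow> top"
proof -
  let ?u = "\<lambda>n \<theta> \<omega>. ennreal (exp (c * Suc n)) * likelihood_ratio (Suc n) \<theta> \<omega>"
  have [measurable]: "(\<lambda>(\<theta>, \<omega>). likelihood_ratio (Suc n) \<theta> \<omega>) \<in> borel_measurable (\<pi> \<Otimes>\<^sub>M P0)" for n
    by (rule likelihood_ratio_measurable) simp
  \<comment> \<open>Divergence is phrased through \<open>liminf\<close>, a jointly measurable
    function, so that the two almost-everywhere quantifiers can be exchanged and Fatou's lemma used
    directly.\<close>
  have "AE \<theta> in \<pi>. AE \<omega> in P0. \<theta> \<in> W \<longrightarrow> liminf (\<lambda>n. ?u n \<theta> \<omega>) = top"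
  proof (rule AE_I2)
    fix \<theta> assume \<theta>: "\<theta> \<in> space \<pi>"
    show "AE \<omega> in P0. \<theta> \<in> W \<longrightarrow> liminf (\<lambda>n. ?u n \<theta> \<omega>) = top"
    proof (cases "\<theta> \<in> W")
      case True
      from AE_likelihood_ratio_growth[OF \<theta> KL[OF True]] show ?thesis
        by eventually_elim (auto dest!: lim_imp_Liminf[OF sequentially_bot])
    qed simp
  qed
  then have "AE \<omega> in P0. AE \<theta> in \<pi>. \<theta> \<in> W \<longrightarrow> liminf (\<lambda>n. ?u n \<theta> \<omega>) = top"
    by (subst (asm) prior_P0.AE_commute) measurable
  then show ?thesis using AE_space
  proof eventually_elim
    case (elim \<omega>)
    have [measurable]: "(\<lambda>\<theta>. likelihood_ratio (Suc n) \<theta> \<omega>) \<in> borel_measurable \<pi>" for n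
      using measurable_Pair1[OF likelihood_ratio_measurable elim(2), of "Suc n"] by simp
    \<comment> \<open>Fatou's lower bound is infinite because \<open>W\<close> has positive prior
      mass.\<close>
    have "(\<integral>\<^sup>+\<theta>. top * indicator W \<theta> \<partial>\<pi>) = top * emeasure \<pi> W"
      by (rule nn_integral_cmult_indicator) measurable
    also have "\<dots> = top"
      using pos by (simp add: prior.emeasure_eq_measure ennreal_top_mult)
    finally have "top = (\<integral>\<^sup>+\<theta>. top * indicator W \<theta> \<partial>\<pi>)" ..
    also have "\<dots> \<le> (\<integral>\<^sup>+\<theta>. liminf (\<lambda>n. ?u n \<theta> \<omega>) \<partial>\<pi>)"
      by (rule nn_integral_mono_AE) (use elim(1) in \<open>eventually_elim, auto simp: indicator_def\<close>)
    also have "\<dots> \<le> liminf (\<lambda>n. \<integral>\<^sup>+\<theta>. ?u n \<theta> \<omega> \<partial>\<pi>)"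
      by (rule nn_integral_liminf) measurable
    also have "(\<lambda>n. \<integral>\<^sup>+\<theta>. ?u n \<theta> \<omega> \<partial>\<pi>) = (\<lambda>n. ennreal (exp (c * Suc n)) * integrated_ratio (Suc n) (space \<pi>) \<omega>)"
      unfolding integrated_ratio_def
      by (rule ext, subst nn_integral_cmult[symmetric]) (auto intro!: nn_integral_cong)
    finally have top: "liminf (\<lambda>n. ennreal (exp (c * Suc n)) * integrated_ratio (Suc n) (space \<pi>) \<omega>) = top"
      by (simp add: top_unique)
    show ?case
    proof (rule Liminf_eq_Limsup)
      show "limsup (\<lambda>n. ennreal (exp (c * Suc n)) * integrated_ratio (Suc n) (space \<pi>) \<omega>) = top"
        using Liminf_le_Limsup[OF sequentially_bot, of "\<lambda>n. ennreal (exp (c * Suc n)) * integrated_ratio (Suc n) (space \<pi>) \<omega>"]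
        unfolding top by (simp add: top_unique)
    qed (use top in auto)
  qed
qed

section \<open>From integrated likelihood ratios to the posterior\<close>

lemma emeasure_posterior_eq:
  assumes n: "1 \<le> n" and \<omega>: "\<omega> \<in> space P0" and pos: "0 < p n \<theta>c (restrict \<omega> {..<n})"
    and A: "A \<in> sets \<pi>"
  shows "emeasure (posterior \<pi> p n \<omega>) A = integrated_ratio n A \<omega> / integrated_ratio n (space \<pi>) \<omega>"
proof -
  have "restrict \<omega> {..<n} \<in> space (prod_n n X)"
    using \<omega> sets_eq_imp_space_eq[OF sets_P0] measurable_space[OF restrict_measurable] by auto
  then have [measurable]: "(\<lambda>\<theta>. p n \<theta> (restrict \<omega> {..<n})) \<in> borel_measurable \<pi>"
    using measurable_Pair1[OF density_measurable[OF n]] by simp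
  define c where "c = ennreal (p n \<theta>c (restrict \<omega> {..<n}))"
  have c: "inverse c \<noteq> 0" "inverse c \<noteq> \<infinity>" using pos by (auto simp: c_def)
  have ratio: "integrated_ratio n B \<omega> = (\<integral>\<^sup>+\<theta>\<in>B. ennreal (p n \<theta> (restrict \<omega> {..<n})) \<partial>\<pi>) * inverse c"
    if [measurable]: "B \<in> sets \<pi>" for B
    unfolding integrated_ratio_def likelihood_ratio_def c_def[symmetric] divide_ennreal_def
    by (subst nn_integral_multc[symmetric]) (auto intro!: nn_integral_cong simp: ac_simps)
  have "(\<integral>\<^sup>+\<theta>\<in>space \<pi>. ennreal (p n \<theta> (restrict \<omega> {..<n})) \<partial>\<pi>) =
      (\<integral>\<^sup>+\<theta>. ennreal (p n \<theta> (restrict \<omega> {..<n})) \<partial>\<pi>)"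
    by (intro nn_integral_cong) simp
  then show ?thesis
    using A by (simp add: emeasure_posterior ratio divide_mult_eq[OF c])
qed

text \<open>The total mass is a quotient of equal quantities, which is 1 once they are neither 0 nor
  infinite. Finiteness holds for all n; being nonzero follows from the growth of the denominator,
  hence only eventually.\<close>

lemma AE_posterior_prob_space:
  assumes W: "W \<in> sets \<pi>" "0 < measure \<pi> W"
    "\<And>\<theta>. \<theta> \<in> W \<Longrightarrow> D_KL (\<nu> 1) (p 1 \<theta>c) (p 1 \<theta>) < ereal c"
  shows "AE \<omega> in P0. \<forall>\<^sub>F n in sequentially. prob_space (posterior \<pi> p (Suc n) \<omega>)"
proof -
  have "AE \<omega> in P0. \<forall>n. integrated_ratio (Suc n) (space \<pi>) \<omega> \<noteq> \<infinity>"
    unfolding AE_all_countable by (intro allI AE_integrated_ratio_finite) simp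
  moreover have "AE \<omega> in P0. \<forall>n. 0 < p (Suc n) \<theta>c (restrict \<omega> {..<Suc n})"
    unfolding AE_all_countable by (intro allI AE_true_density_pos) simp
  moreover have "AE \<omega> in P0. (\<lambda>n. ennreal (exp (c * Suc n)) * integrated_ratio (Suc n) (space \<pi>) \<omega>) \<longlonglongrightarrow> top"
    by (rule AE_integrated_ratio_growth[OF W])
  ultimately show ?thesis using AE_space
  proof eventually_elim
    case (elim \<omega>)
    note elim_outer = elim
    have sp: "space (posterior \<pi> p (Suc n) \<omega>) = space \<pi>" for n by (simp add: posterior_def)
    have "\<forall>\<^sub>F n in sequentially. 0 < ennreal (exp (c * Suc n)) * integrated_ratio (Suc n) (space \<pi>) \<omega>"
      by (rule order_tendstoD(1)[OF elim(3)]) simp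
    then show ?case
    proof eventually_elim
      case (elim n)
      then have "integrated_ratio (Suc n) (space \<pi>) \<omega> \<noteq> 0" by (auto simp: zero_less_iff_neq_zero)
      moreover have "integrated_ratio (Suc n) (space \<pi>) \<omega> \<noteq> \<infinity>" using elim_outer(1) by auto
      ultimately show ?case
        by (intro prob_spaceI)
           (simp add: sp emeasure_posterior_eq elim_outer less_top)
    qed
  qed
qed

lemma AE_posterior_concentrates:
  fixes \<phi> :: "(nat \<Rightarrow> 'b) \<Rightarrow> real"
  assumes KL: "\<And>c. 0 < c \<Longrightarrow> \<exists>W\<in>sets \<pi>. 0 < measure \<pi> W \<and>
      (\<forall>\<theta>\<in>W. D_KL (\<nu> 1) (p 1 \<theta>c) (p 1 \<theta>) < ereal c)"
    and k: "1 \<le> k" and A: "A \<in> sets \<pi>" and \<phi>: "\<phi> \<in> borel_measurable (prod_n k X)"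
      "\<And>\<xi>. \<xi> \<in> space (prod_n k X) \<Longrightarrow> 0 \<le> \<phi> \<xi> \<and> \<phi> \<xi> \<le> 1"
      "(\<integral>\<xi>. \<phi> \<xi> \<partial>prod_n k (P \<theta>c)) \<le> 1 / 10"
      "\<And>\<theta>. \<theta> \<in> A \<Longrightarrow> (\<integral>\<xi>. 1 - \<phi> \<xi> \<partial>prod_n k (P \<theta>)) \<le> 1 / 10"
  shows "AE \<omega> in P0. (\<lambda>n. emeasure (posterior \<pi> p (Suc n) \<omega>) A) \<longlonglongrightarrow> 0"
proof -
  \<comment> \<open>Chosen so that \<open>exp (c * k) = 3 / 2\<close>, the growth per block allowed
    by the numerator bound. As \<open>k\<close> comes from the test, \<open>KL\<close> must be
    available for arbitrarily small \<open>c\<close>.\<close>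
  define c :: real where "c = ln (3 / 2) / k"
  have "0 < c" using k by (simp add: c_def)
  then obtain W where W: "W \<in> sets \<pi>" "0 < measure \<pi> W"
    "\<And>\<theta>. \<theta> \<in> W \<Longrightarrow> D_KL (\<nu> 1) (p 1 \<theta>c) (p 1 \<theta>) < ereal c"
    using KL by blast
  \<comment> \<open>The additional factor \<open>3 / 2\<close> pays for the incomplete last
    block.\<close>
  have exp_le: "exp (c * n) \<le> 3 / 2 * (3 / 2) ^ (n div k)" for n :: nat
  proof -
    have "n \<le> k * (n div k) + k"
      using mod_less_divisor[of k n] k mult_div_mod_eq[of k n] by linarith
    then have "n \<le> k * (n div k + 1)" by simp
    then have "real n \<le> real k * real (n div k + 1)" by (metis of_nat_le_iff of_nat_mult)
    then have "c * n \<le> c * (real k * real (n div k + 1))"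
      using \<open>0 < c\<close> by (intro mult_left_mono) auto
    also have "\<dots> = real (n div k + 1) * ln (3 / 2)" using k by (simp add: c_def)
    finally have "exp (c * n) \<le> exp (real (n div k + 1) * ln (3 / 2))" by simp
    also have "\<dots> = (3 / 2) ^ (n div k + 1)"
      by (simp only: exp_of_nat_mult) simp
    finally show ?thesis by simp
  qed
  have "AE \<omega> in P0. \<forall>n. 0 < p (Suc n) \<theta>c (restrict \<omega> {..<Suc n})"
    unfolding AE_all_countable by (intro allI AE_true_density_pos) simp
  moreover have "AE \<omega> in P0. (\<lambda>n. ennreal ((3 / 2) ^ (Suc n div k)) * integrated_ratio (Suc n) A \<omega>) \<longlonglongrightarrow> 0"
    by (rule AE_integrated_ratio_exponentially_small[OF k A \<phi>])
  moreover have "AE \<omega> in P0. (\<lambda>n. ennreal (exp (c * Suc n)) * integrated_ratio (Suc n) (space \<pi>) \<omega>) \<longlonglongrightarrow> top"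
    by (rule AE_integrated_ratio_growth[OF W])
  ultimately show ?thesis using AE_space
  proof eventually_elim
    case (elim \<omega>)
    note elim_outer = elim
    let ?N = "\<lambda>n. integrated_ratio (Suc n) A \<omega>" and ?D = "\<lambda>n. integrated_ratio (Suc n) (space \<pi>) \<omega>"
    have "(\<lambda>n. ennreal (3 / 2) * (ennreal ((3 / 2) ^ (Suc n div k)) * ?N n)) \<longlonglongrightarrow> ennreal (3 / 2) * 0"
      by (rule tendsto_mult_ennreal[OF tendsto_const elim(2)]) simp
    then have lim: "(\<lambda>n. ennreal (3 / 2 * (3 / 2) ^ (Suc n div k)) * ?N n) \<longlonglongrightarrow> 0"
      by (subst ennreal_mult) (simp_all only: mult.assoc mult_zero_right, simp_all)
    \<comment> \<open>Once this product exceeds 1, extending the posterior quotient by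
      \<open>exp (c * Suc n)\<close> and dropping the denominator only increases it, and the
      numerator bound finishes.\<close>
    have "\<forall>\<^sub>F n in sequentially. 1 < ennreal (exp (c * Suc n)) * ?D n"
      by (rule order_tendstoD(1)[OF elim(3)]) simp
    then have le: "\<forall>\<^sub>F n in sequentially. emeasure (posterior \<pi> p (Suc n) \<omega>) A
        \<le> ennreal (3 / 2 * (3 / 2) ^ (Suc n div k)) * ?N n"
    proof eventually_elim
      case (elim n)
      let ?e = "ennreal (exp (c * Suc n))"
      have "emeasure (posterior \<pi> p (Suc n) \<omega>) A = ?N n / ?D n"
        by (rule emeasure_posterior_eq) (use elim_outer A in auto)
      also have "\<dots> = (?N n * ?e) / (?D n * ?e)"
        by (rule divide_mult_eq[symmetric]) auto
      also have "\<dots> \<le> ?N n * ?e * 1"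
      proof -
        have "inverse y \<le> 1" if "1 < y" for y :: ennreal
          using that by (cases y) (auto simp: inverse_ennreal inverse_le_1_iff)
        from this[of "?D n * ?e"] show ?thesis
          unfolding divide_ennreal_def using elim by (intro mult_left_mono) (auto simp: mult.commute)
      qed
      also have "\<dots> \<le> ennreal (3 / 2 * (3 / 2) ^ (Suc n div k)) * ?N n"
        using exp_le[of "Suc n"] by (simp add: mult.commute[of "?N n"] ennreal_leI mult_right_mono del: of_nat_Suc)
      finally show ?case .
    qed
    show ?case
      by (rule tendsto_sandwich[OF _ le tendsto_const lim]) simp
  qed
qed

end

text \<open>Consistency enters through one fixed sample size, which later becomes the block length;
  it is taken at least 1 so that blocks are nonempty.\<close>

lemma uniformly_consistent_testsE:
  assumes "uniformly_consistent_tests \<Theta> \<Xi> P \<theta>c V \<phi>" and e: "0 < e"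
  obtains k where "1 \<le> k" "\<phi> k \<in> borel_measurable (prod_n k (borel_on \<Xi>))"
    "\<And>\<xi>. \<xi> \<in> space (prod_n k (borel_on \<Xi>)) \<Longrightarrow> 0 \<le> \<phi> k \<xi> \<and> \<phi> k \<xi> \<le> 1"
    "(\<integral>\<xi>. \<phi> k \<xi> \<partial>prod_n k (P \<theta>c)) \<le> e"
    "\<And>\<theta>. \<theta> \<in> \<Theta> - V \<Longrightarrow> (\<integral>\<xi>. 1 - \<phi> k \<xi> \<partial>prod_n k (P \<theta>)) \<le> e"
proof -
  let ?s = "\<lambda>n. SUP \<theta>\<in>\<Theta> - V. ennreal (\<integral>\<xi>. 1 - \<phi> n \<xi> \<partial>prod_n n (P \<theta>))"
  have lim: "(\<lambda>n. \<integral>\<xi>. \<phi> n \<xi> \<partial>prod_n n (P \<theta>c)) \<longlonglongrightarrow> 0" "?s \<longlonglongrightarrow> 0"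
    using assms(1) unfolding uniformly_consistent_tests_def by auto
  have "\<forall>\<^sub>F n in sequentially. (\<integral>\<xi>. \<phi> n \<xi> \<partial>prod_n n (P \<theta>c)) < e \<and> ?s n < ennreal e \<and> 1 \<le> n"
    by (intro eventually_conj order_tendstoD(2)[OF lim(1)] order_tendstoD(2)[OF lim(2)]
        eventually_ge_at_top) (use e in auto)
  then obtain k where k: "(\<integral>\<xi>. \<phi> k \<xi> \<partial>prod_n k (P \<theta>c)) < e" "?s k < ennreal e" "1 \<le> k"
    by (metis (mono_tags, lifting) eventually_sequentially order_refl)
  show thesis
  proof (rule that)
    fix \<theta> assume "\<theta> \<in> \<Theta> - V"
    then have "ennreal (\<integral>\<xi>. 1 - \<phi> k \<xi> \<partial>prod_n k (P \<theta>)) \<le> ?s k" by (rule SUP_upper)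
    with k(2) have "ennreal (\<integral>\<xi>. 1 - \<phi> k \<xi> \<partial>prod_n k (P \<theta>)) \<le> ennreal e" by order
    then show "(\<integral>\<xi>. 1 - \<phi> k \<xi> \<partial>prod_n k (P \<theta>)) \<le> e"
      using e by (simp add: ennreal_le_iff)
  qed (use k assms(1) in \<open>auto simp: uniformly_consistent_tests_def\<close>)
qed

section \<open>Deduction of the four limits from concentration at the true parameter\<close>

theorem theorem3p1:
  fixes \<Theta> :: "(real ^ 'l) set" and \<Xi> :: "(real ^ 'm) set" and \<X> :: "(real ^ 'd) set"
    and \<pi> :: "(real ^ 'l) measure" and P :: "real ^ 'l \<Rightarrow> (real ^ 'm) measure"
    and \<theta>c :: "real ^ 'l"
    and h :: "real ^ 'd \<Rightarrow> real ^ 'm \<Rightarrow> real"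
    and \<nu> :: "nat \<Rightarrow> (nat \<Rightarrow> real ^ 'm) measure"
    and p :: "nat \<Rightarrow> real ^ 'l \<Rightarrow> (nat \<Rightarrow> real ^ 'm) \<Rightarrow> real"
  assumes prior: "prob_space \<pi>" "sets \<pi> = sets (borel_on \<Theta>)"
    and model: "\<And>\<theta>. \<theta> \<in> \<Theta> \<Longrightarrow> prob_space (P \<theta>)"
      "\<And>\<theta>. \<theta> \<in> \<Theta> \<Longrightarrow> sets (P \<theta>) = sets (borel_on \<Xi>)"
    and kernel: "\<And>B. B \<in> sets (prod_inf (borel_on \<Xi>)) \<Longrightarrow>
      (\<lambda>\<theta>. emeasure (prod_inf (P \<theta>)) B) \<in> borel_measurable (borel_on \<Theta>)"
    and true_param: "\<theta>c \<in> \<Theta>"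
    and closed_X: "closed \<X>"
    and H_finite: "\<And>x \<theta>. x \<in> \<X> \<Longrightarrow> \<theta> \<in> \<Theta> \<Longrightarrow> integrable (P \<theta>) (h x)"
    and compact_Theta: "compact \<Theta>"
    and dominating: "\<And>n. n \<ge> 1 \<Longrightarrow> sigma_finite_measure (\<nu> n)"
      "\<And>n. n \<ge> 1 \<Longrightarrow> sets (\<nu> n) = sets (prod_n n (borel_on \<Xi>))"
    and densities: "\<And>n \<theta> \<xi>. n \<ge> 1 \<Longrightarrow> \<theta> \<in> \<Theta> \<Longrightarrow>
        \<xi> \<in> space (prod_n n (borel_on \<Xi>)) \<Longrightarrow> 0 \<le> p n \<theta> \<xi>"
      "\<And>n \<theta>. n \<ge> 1 \<Longrightarrow> \<theta> \<in> \<Theta> \<Longrightarrow>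
        prod_n n (P \<theta>) = density (\<nu> n) (\<lambda>\<xi>. ennreal (p n \<theta> \<xi>))"
      "\<And>n. n \<ge> 1 \<Longrightarrow>
        (\<lambda>(\<theta>, \<xi>). p n \<theta> \<xi>)
          \<in> borel_measurable (borel_on \<Theta> \<Otimes>\<^sub>M prod_n n (borel_on \<Xi>))"
    and tests: "\<And>V. V \<in> sets (borel_on \<Theta>) \<Longrightarrow> nbhd_in \<Theta> \<theta>c V \<Longrightarrow>
      \<exists>\<phi>. uniformly_consistent_tests \<Theta> \<Xi> P \<theta>c V \<phi>"
    and KL_support: "\<And>\<epsilon> V. (0::real) < \<epsilon> \<Longrightarrow> V \<in> sets (borel_on \<Theta>) \<Longrightarrow> nbhd_in \<Theta> \<theta>c V \<Longrightarrow>
      \<exists>W \<in> sets \<pi>. W \<subseteq> V \<and> measure \<pi> W > 0 \<and>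
        (\<forall>\<theta>\<in>W. D_KL (\<nu> 1) (p 1 \<theta>c) (p 1 \<theta>) < ereal \<epsilon>)"
    and H_cont: "\<And>x. x \<in> \<X> \<Longrightarrow> continuous_on \<Theta> (mean_cost P h x)"
  shows "\<forall>x\<in>\<X>.
    (AE \<omega> in prod_inf (P \<theta>c).
      (\<lambda>n. mean_risk (posterior \<pi> p n \<omega>) (mean_cost P h x)) \<longlonglongrightarrow> mean_cost P h x \<theta>c) \<and>
    (\<forall>w\<ge>0. AE \<omega> in prod_inf (P \<theta>c).
      (\<lambda>n. mean_variance_risk w (posterior \<pi> p n \<omega>) (mean_cost P h x))
        \<longlonglongrightarrow> mean_cost P h x \<theta>c) \<and>
    (\<forall>\<alpha>\<in>{0<..<1}. AE \<omega> in prod_inf (P \<theta>c).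
      (\<lambda>n. VaR \<alpha> (posterior \<pi> p n \<omega>) (mean_cost P h x)) \<longlonglongrightarrow> mean_cost P h x \<theta>c) \<and>
    (\<forall>\<alpha>\<in>{0<..<1}. AE \<omega> in prod_inf (P \<theta>c).
      (\<lambda>n. CVaR \<alpha> (posterior \<pi> p n \<omega>) (mean_cost P h x)) \<longlonglongrightarrow> mean_cost P h x \<theta>c)"
proof
  let "\<forall>x\<in>_. ?goal x" = ?thesis
  fix x assume x: "x \<in> \<X>"
  note space_prior = sets_eq_imp_space_eq[OF prior(2)]
  have space_prior': "space \<pi> = \<Theta>" using space_prior by (simp add: space_restrict_space)
  interpret dominated_family \<pi> "borel_on \<Xi>" P \<theta>c \<nu> p
    by (rule dominated_family.intro)
       (use prior model true_param dominating densities space_prior' in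
         \<open>simp_all cong: measurable_cong_sets sets_pair_measure_cong\<close>)
  let ?f = "mean_cost P h x"
  obtain B where B: "\<And>\<theta>. \<theta> \<in> \<Theta> \<Longrightarrow> \<bar>?f \<theta>\<bar> \<le> B"
    using compact_imp_bounded[OF compact_continuous_image[OF H_cont[OF x] compact_Theta]]
    by (auto simp: bounded_iff)
  have f_meas: "?f \<in> borel_measurable \<pi>"
    using borel_measurable_continuous_on_restrict[OF H_cont[OF x]]
    by (simp cong: measurable_cong_sets[OF prior(2)])
  \<comment> \<open>A countable neighbourhood base: concentration on all \<open>V j\<close> then
    holds outside a single null set.\<close>
  define V where "V j = \<Theta> \<inter> ball \<theta>c (inverse (real (Suc j)))" for j
  have V_sets: "V j \<in> sets (borel_on \<Theta>)" for j
    by (auto simp: V_def sets_restrict_space)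
  have V_nbhd: "nbhd_in \<Theta> \<theta>c (V j)" for j
    unfolding nbhd_in_def V_def using true_param
    by (intro conjI exI[of _ "\<Theta> \<inter> ball \<theta>c (inverse (real (Suc j)))"] openin_open_Int) auto
  have KL: "\<exists>W\<in>sets \<pi>. 0 < measure \<pi> W \<and> (\<forall>\<theta>\<in>W. D_KL (\<nu> 1) (p 1 \<theta>c) (p 1 \<theta>) < ereal c)"
    if "0 < c" for c
    using KL_support[OF that V_sets V_nbhd, of 0] by auto
  have "AE \<omega> in P0. \<forall>j. (\<lambda>n. emeasure (posterior \<pi> p (Suc n) \<omega>) (\<Theta> - V j)) \<longlonglongrightarrow> 0"
    unfolding AE_all_countable
  proof
    fix j
    obtain \<phi> where "uniformly_consistent_tests \<Theta> \<Xi> P \<theta>c (V j) \<phi>"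
      using tests[OF V_sets V_nbhd] by blast
    then obtain k where k: "1 \<le> k" "\<phi> k \<in> borel_measurable (prod_n k (borel_on \<Xi>))"
      "\<And>\<xi>. \<xi> \<in> space (prod_n k (borel_on \<Xi>)) \<Longrightarrow> 0 \<le> \<phi> k \<xi> \<and> \<phi> k \<xi> \<le> 1"
      "(\<integral>\<xi>. \<phi> k \<xi> \<partial>prod_n k (P \<theta>c)) \<le> 1 / 10"
      "\<And>\<theta>. \<theta> \<in> \<Theta> - V j \<Longrightarrow> (\<integral>\<xi>. 1 - \<phi> k \<xi> \<partial>prod_n k (P \<theta>)) \<le> 1 / 10"
      by (rule uniformly_consistent_testsE[where e = "1 / 10"]) auto
    have "\<Theta> - V j \<in> sets \<pi>"
      using sets.compl_sets[of "V j" \<pi>] V_sets prior(2) space_prior' by simp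
    from AE_posterior_concentrates[OF KL k(1) this k(2-5)]
    show "AE \<omega> in P0. (\<lambda>n. emeasure (posterior \<pi> p (Suc n) \<omega>) (\<Theta> - V j)) \<longlonglongrightarrow> 0" .
  qed
  moreover obtain W where "W \<in> sets \<pi>" "0 < measure \<pi> W"
      "\<And>\<theta>. \<theta> \<in> W \<Longrightarrow> D_KL (\<nu> 1) (p 1 \<theta>c) (p 1 \<theta>) < ereal 1"
    using KL[of 1] by auto
  then have "AE \<omega> in P0. \<forall>\<^sub>F n in sequentially. prob_space (posterior \<pi> p (Suc n) \<omega>)"
    by (rule AE_posterior_prob_space)
  \<comment> \<open>One event serves all weights and levels, because it concerns the posterior
    alone.\<close>
  ultimately have "AE \<omega> in P0.
      (\<lambda>n. mean_risk (posterior \<pi> p n \<omega>) ?f) \<longlonglongrightarrow> ?f \<theta>c \<and>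
      (\<forall>w. (\<lambda>n. mean_variance_risk w (posterior \<pi> p n \<omega>) ?f) \<longlonglongrightarrow> ?f \<theta>c) \<and>
      (\<forall>\<alpha>\<in>{0<..<1}. (\<lambda>n. VaR \<alpha> (posterior \<pi> p n \<omega>) ?f) \<longlonglongrightarrow> ?f \<theta>c) \<and>
      (\<forall>\<alpha>\<in>{0<..<1}. (\<lambda>n. CVaR \<alpha> (posterior \<pi> p n \<omega>) ?f) \<longlonglongrightarrow> ?f \<theta>c)"
  proof eventually_elim
    case (elim \<omega>)
    let ?Q = "\<lambda>n. posterior \<pi> p (Suc n) \<omega>"
    have space_Q: "space (?Q n) = \<Theta>" and sets_Q: "sets (?Q n) = sets \<pi>" for n
      by (simp_all add: posterior_def space_prior')
    have meas: "?f \<in> borel_measurable (?Q n)" for n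
      using f_meas by (simp cong: measurable_cong_sets[OF sets_Q])
    \<comment> \<open>Continuity at \<open>\<theta>c\<close> places the deviation event inside the
      complement of some \<open>V j\<close>.\<close>
    have conv: "(\<lambda>n. measure (?Q n) {\<theta>\<in>space (?Q n). e \<le> \<bar>?f \<theta> - ?f \<theta>c\<bar>}) \<longlonglongrightarrow> 0" if e: "0 < e" for e
    proof -
      obtain d where d: "0 < d" "\<And>\<theta>. \<theta> \<in> \<Theta> \<Longrightarrow> dist \<theta> \<theta>c < d \<Longrightarrow> dist (?f \<theta>) (?f \<theta>c) < e"
        using H_cont[OF x] true_param e unfolding continuous_on_iff by metis
      obtain j where j: "inverse (real (Suc j)) < d" using reals_Archimedean[OF d(1)] by blast
      have sub: "{\<theta>\<in>\<Theta>. e \<le> \<bar>?f \<theta> - ?f \<theta>c\<bar>} \<subseteq> \<Theta> - V j"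
      proof
        fix \<theta> assume \<theta>: "\<theta> \<in> {\<theta>\<in>\<Theta>. e \<le> \<bar>?f \<theta> - ?f \<theta>c\<bar>}"
        then have "\<not> dist \<theta> \<theta>c < d" using d(2)[of \<theta>] by (auto simp: dist_real_def)
        with \<theta> j show "\<theta> \<in> \<Theta> - V j" by (auto simp: V_def dist_commute)
      qed
      have V\<pi>: "\<Theta> - V j \<in> sets \<pi>"
        using sets.compl_sets[of "V j" \<pi>] V_sets prior(2) space_prior' by simp
      have lim: "(\<lambda>n. measure (?Q n) (\<Theta> - V j)) \<longlonglongrightarrow> 0"
        unfolding measure_def by (rule tendsto_enn2real) (use elim(1) in simp_all)
      \<comment> \<open>The comparison is only eventual: monotonicity of the real-valued
        \<open>measure\<close> uses that the posterior is finite.\<close>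
      show ?thesis
      proof (rule tendsto_sandwich[OF _ _ tendsto_const lim])
        show "\<forall>\<^sub>F n in sequentially. measure (?Q n) {\<theta>\<in>space (?Q n). e \<le> \<bar>?f \<theta> - ?f \<theta>c\<bar>}
            \<le> measure (?Q n) (\<Theta> - V j)"
          using elim(2)
        proof eventually_elim
          case (elim n)
          interpret prob_space "?Q n" by (rule elim)
          show ?case unfolding space_Q by (rule finite_measure_mono[OF sub]) (simp add: sets_Q V\<pi>)
        qed
      qed simp
    qed
    have bound: "\<bar>?f \<theta>\<bar> \<le> B" if "\<theta> \<in> space (?Q n)" for \<theta> n
      using B that unfolding space_Q by blast
    note risks = risks_tendsto[OF elim(2) meas bound conv]
    show ?case
      \<comment> \<open>\<open>LIMSEQ_imp_Suc\<close> returns from sample sizes \<open>Suc n\<close>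
        to all n, where size 0 is irrelevant to the limit.\<close>
      by (intro conjI allI ballI; rule LIMSEQ_imp_Suc; rule risks; simp)
  qed
  then show "?goal x" by (intro conjI allI impI ballI; elim eventually_mono; simp)
qed

end
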